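(* Let $G$ be a finitely generated group, let $S$ be a finite set, and let $(\Sigma(G,S),G)$ be the Bernoulli shift. Given a finite symmetric set of generators $G^1=G^{1+}\sqcup G^{1-}$ of $G$ and an injective map $\alpha: G^{1+}\times S\to F_n^{1+}$, there exists a topological embedding $$\Phi_\alpha:\Sigma(G,S)\to X_n$$ which is an orbit equivalence. Moreover, for any $\sigma\in\Sigma(G,S)$ and $g\in G^{1+}$, $$\Phi_\alpha(\sigma\cdot g)=\Phi_\alpha(\sigma)\cdot\alpha(g,\sigma(e)),$$ and if $g^{-1}\in G^{1+}$ then $$\Phi_\alpha(\sigma\cdot g)=\Phi_\alpha(\sigma)\cdot\bigl[\alpha(g^{-1},\sigma(g))\bigr]^{-1}.$$ (The equalities include the assertion that the partial actions on the right-hand sides are defined.)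
   Context: Bernoulli shift: $\Sigma(G,S)$ is the set of all maps $\sigma:G\to S$ with the product topology ($S$ discrete), with the right action of $G$ given by $(\sigma\cdot g)(g')=\sigma(gg')$; $e$ denotes the identity element. Generators: $G^1$ is a finite set of generators of $G$ not containing $e$, with $(G^1)^{-1}=G^1$, divided into a positive part $G^{1+}$ and a negative part $G^{1-}=(G^{1+})^{-1}$. $F_n$ is the free group on $n$ generators, and $F_n^{1+}$ is its set of $n$ free (positive) generators. The space of pointed trees $X_n$: let $\mathcal F_n$ be the Cayley graph of $F_n$ with vertex set $F_n$ and, for every $g\in F_n$ and $h\in F_n^{1+}$, one edge joining $g$ to $gh$, labeled by $h$ (and directed from $g$ to $gh$). Every edge has length $1$. $X_n$ is the set of all subgraphs $T\subset\mathcal F_n$ that are non-compact (i.e. infinite), connected and simply connected (i.e. infinite subtrees) and contain $e$ as a vertex; $T$ is regarded as the pointed metric space $(T,e)$ with its path-length metric. Two pointed subgraphs $(A,g_1)$, $(B,g_2)$ are isomorphic if there is an isometry $A\to B$ sending $g_1$ to $g_2$ and preserving the labels and directions of edges. $X_n$ has the metric $d_X(T,T')=e^{-r(T,T')}$, where $r(T,T')$ is the maximal $r\in\mathbb N\cup\{0\}$ such that the balls $B_T(e,r)$ and $B_{T'}(e,r)$ are isomorphic as subgraphs pointed at $e$ (with $d_X(T,T')=0$ if $T=T'$). Partial action of $F_n$ on $X_n$: for $T\in X_n$ and $f\in F_n$, $T\cdot f$ is defined if and only if $f$ is a vertex of $T$, and then $T\cdot f$ is the unique $T'\in X_n$ such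 that $(T',e)$ is isomorphic to $(T,f)$ (i.e. $T'=f^{-1}T$). For $f\in F_n$ let $\tau_f:T\mapsto T\cdot f$, defined on the set of $T\in X_n$ for which $T\cdot f$ is defined. $\mathfrak G_n$ is the pseudogroup of local homeomorphisms of $X_n$ generated by $\{\tau_f\mid f\in F_n\}$; the $\mathfrak G_n$-orbit of $T$ is $\{T\cdot f\mid f\in F_n,\ T\cdot f\text{ defined}\}$. Orbit equivalence: $\Phi_\alpha$ maps the $G$-orbit of each $\sigma\in\Sigma(G,S)$ onto the $\mathfrak G_n$-orbit of $\Phi_\alpha(\sigma)$.
   Formalization: The group G is assumed nontrivial: for trivial G the generating set is empty and the claim fails, e.g. for n = 0 and nonempty S the space X_0 of infinite trees is empty while Σ(G,S) is not. *)

theory Defs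
  imports
    "HOL-Analysis.Analysis"
    "HOL-Algebra.Generated_Groups"
    "Graph_Theory.Digraph_Component"
begin

section \<open>Bernoulli shifts\<close>

definition bernoulli_topology :: "('g, 'm) monoid_scheme \<Rightarrow> 's set \<Rightarrow> ('g \<Rightarrow> 's) topology" where
  "bernoulli_topology G S = product_topology (\<lambda>_. discrete_topology S) (carrier G)"

definition bernoulli_space :: "('g, 'm) monoid_scheme \<Rightarrow> 's set \<Rightarrow> ('g \<Rightarrow> 's) set" where
  "bernoulli_space G S = (carrier G \<rightarrow>\<^sub>E S)"

lemma topspace_bernoulli: "topspace (bernoulli_topology G S) = bernoulli_space G S"
  by (simp add: bernoulli_topology_def bernoulli_space_def)

definition shift :: "('g, 'm) monoid_scheme \<Rightarrow> ('g \<Rightarrow> 's) \<Rightarrow> 'g \<Rightarrow> ('g \<Rightarrow> 's)" where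
  "shift G \<sigma> g = (\<lambda>g'\<in>carrier G. \<sigma> (g \<otimes>\<^bsub>G\<^esub> g'))"

definition shift_orbit :: "('g, 'm) monoid_scheme \<Rightarrow> ('g \<Rightarrow> 's) \<Rightarrow> ('g \<Rightarrow> 's) set" where
  "shift_orbit G \<sigma> = {shift G \<sigma> g | g. g \<in> carrier G}"


section \<open>The free group on \<open>n\<close> generators\<close>

text \<open>
  Elements are reduced words. The letter \<open>(i, True)\<close> is the \<open>i\<close>-th free generator and
  \<open>(i, False)\<close> is its inverse.
\<close>

type_synonym letter = "nat \<times> bool"

definition flip :: "letter \<Rightarrow> letter" where
  "flip x = (fst x, \<not> snd x)"

definition reduced_word :: "letter list \<Rightarrow> bool" where
  "reduced_word w \<longleftrightarrow> successively (\<lambda>x y. y \<noteq> flip x) w"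

fun push :: "letter \<Rightarrow> letter list \<Rightarrow> letter list" where
  "push x [] = [x]"
| "push x (y # w) = (if y = flip x then w else x # y # w)"

definition free_group :: "nat \<Rightarrow> letter list monoid" where
  "free_group n =
    \<lparr>carrier = {w. reduced_word w \<and> fst ` set w \<subseteq> {..<n}},
     monoid.mult = (\<lambda>u v. foldr push u v),
     one = []\<rparr>"

definition free_gens :: "nat \<Rightarrow> letter list set" where
  "free_gens n = {[(i, True)] | i. i < n}"

lemma flip_flip [simp]: "flip (flip x) = x"
  by (simp add: flip_def)

lemma flip_neq [simp]: "flip x \<noteq> x" "x \<noteq> flip x"
  by (auto simp: flip_def prod_eq_iff)

lemma fst_flip [simp]: "fst (flip x) = fst x"
  by (simp add: flip_def)

lemma reduced_Nil [simp]: "reduced_word []"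
  by (simp add: reduced_word_def)

lemma reduced_Cons: "reduced_word (x # w) \<longleftrightarrow> reduced_word w \<and> (w = [] \<or> hd w \<noteq> flip x)"
  by (cases w) (auto simp: reduced_word_def)

lemma reduced_push: "reduced_word w \<Longrightarrow> reduced_word (push x w)"
  by (cases w) (auto simp: reduced_Cons)

lemma reduced_foldr_push: "reduced_word w \<Longrightarrow> reduced_word (foldr push u w)"
  by (induction u) (auto intro: reduced_push)

lemma letters_push: "fst ` set (push x w) \<subseteq> insert (fst x) (fst ` set w)"
  by (cases w) auto

lemma letters_foldr_push: "fst ` set (foldr push u w) \<subseteq> fst ` set u \<union> fst ` set w"
proof (induction u)
  case (Cons x u)
  then show ?case
    using letters_push[of x "foldr push u w"] by (simp add: subset_iff) blast
qed simp

lemma push_flip_push: "reduced_word w \<Longrightarrow> push (flip x) (push x w) = w"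
  by (cases w rule: list.exhaust; cases "tl w") (auto simp: reduced_Cons)

lemma push_push_flip: "reduced_word w \<Longrightarrow> push x (push (flip x) w) = w"
  using push_flip_push[of w "flip x"] by simp

lemma push_reduced: "reduced_word (x # w) \<Longrightarrow> push x w = x # w"
  by (cases w) (auto simp: reduced_Cons)

lemma foldr_push_Nil: "reduced_word u \<Longrightarrow> foldr push u [] = u"
  by (induction u) (auto simp: push_reduced reduced_Cons)

lemma foldr_push_push: "reduced_word w \<Longrightarrow> foldr push (push x u) w = push x (foldr push u w)"
  by (cases u) (auto simp: push_push_flip reduced_foldr_push)

lemma foldr_push_assoc:
  "reduced_word w \<Longrightarrow> foldr push (foldr push u v) w = foldr push u (foldr push v w)"
  by (induction u) (auto simp: foldr_push_push)

lemma foldr_push_inverse: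
  "reduced_word w \<Longrightarrow> foldr push (rev (map flip u)) (foldr push u w) = w"
  by (induction u arbitrary: w) (auto simp: push_flip_push reduced_foldr_push)

lemma reduced_inverse: "reduced_word u \<Longrightarrow> reduced_word (rev (map flip u))"
  unfolding reduced_word_def successively_rev successively_map
  by (erule successively_mono) auto

lemma group_free_group: "group (free_group n)"
proof (rule groupI)
  fix x assume x: "x \<in> carrier (free_group n)"
  show "\<exists>y\<in>carrier (free_group n). y \<otimes>\<^bsub>free_group n\<^esub> x = \<one>\<^bsub>free_group n\<^esub>"
  proof
    show "rev (map flip x) \<in> carrier (free_group n)"
      using x reduced_inverse by (auto simp: free_group_def)
    show "rev (map flip x) \<otimes>\<^bsub>free_group n\<^esub> x = \<one>\<^bsub>free_group n\<^esub>"
      using x foldr_push_inverse[of "[]" x] by (simp add: free_group_def foldr_push_Nil)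
  qed
next
  fix x y assume "x \<in> carrier (free_group n)" "y \<in> carrier (free_group n)"
  then show "x \<otimes>\<^bsub>free_group n\<^esub> y \<in> carrier (free_group n)"
    using letters_foldr_push[of x y] by (simp add: free_group_def reduced_foldr_push) blast
qed (auto simp: free_group_def foldr_push_assoc)


section \<open>The Cayley graph and its pointed subtrees\<close>

text \<open>
  The edge joining \<open>g\<close> to \<open>gh\<close> is the arc \<open>(g, h)\<close>; its label is the second component.
\<close>

type_synonym lgraph = "(letter list, letter list \<times> letter list) pre_digraph"

definition cayley :: "nat \<Rightarrow> lgraph" where
  "cayley n =
    \<lparr>verts = carrier (free_group n),
     arcs = carrier (free_group n) \<times> free_gens n,
     tail = fst,
     head = (\<lambda>(g, h). g \<otimes>\<^bsub>free_group n\<^esub> h)\<rparr>"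

lemma free_gens_carrier: "free_gens n \<subseteq> carrier (free_group n)"
  by (auto simp: free_gens_def free_group_def reduced_Cons)

lemma wf_digraph_cayley: "wf_digraph (cayley n)"
  using free_gens_carrier[of n] monoid.m_closed[OF group.is_monoid[OF group_free_group[of n]]]
  by unfold_locales (auto simp: cayley_def)

text \<open>
  The topology and metric of a graph ignore the direction of its edges. In
  \<open>two_way T\<close> every arc \<open>a\<close> may be traversed forwards as \<open>(a, True)\<close> and backwards as
  \<open>(a, False)\<close>, so its arc walks are the undirected edge paths of \<open>T\<close>.
\<close>

definition two_way :: "('a, 'b) pre_digraph \<Rightarrow> ('a, 'b \<times> bool) pre_digraph" where
  "two_way T =
    \<lparr>verts = verts T,
     arcs = arcs T \<times> UNIV,
     tail = (\<lambda>(a, b). if b then tail T a else head T a),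
     head = (\<lambda>(a, b). if b then head T a else tail T a)\<rparr>"

text \<open>
  A connected graph is simply connected iff it has no closed edge path of positive length
  without backtracking. (The constants \<open>forest\<close> and \<open>tree\<close> of the graph library only exclude
  directed cycles.)
\<close>

definition acyclic_graph :: "('a, 'b) pre_digraph \<Rightarrow> bool" where
  "acyclic_graph T \<longleftrightarrow>
    (\<forall>u p. pre_digraph.awalk (two_way T) u p u \<and>
           successively (\<lambda>(a, b) (a', b'). \<not> (a' = a \<and> b' = (\<not> b))) p \<longrightarrow> p = [])"

definition tree_space :: "nat \<Rightarrow> lgraph set" where
  "tree_space n =
    {T. subgraph T (cayley n) \<and> infinite (verts T) \<and>
        Digraph_Component.connected T \<and> acyclic_graph T \<and>
        \<one>\<^bsub>free_group n\<^esub> \<in> verts T}"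

text \<open>Path-length distance between vertices; only meaningful on connected graphs.\<close>

definition gdist :: "('a, 'b) pre_digraph \<Rightarrow> 'a \<Rightarrow> 'a \<Rightarrow> nat" where
  "gdist T u v = (LEAST k. \<exists>p. pre_digraph.awalk (two_way T) u p v \<and> length p = k)"

text \<open>
  In a tree the ends of an edge lie at different distances from \<open>u\<close>, so the closed metric ball of
  integer radius consists of the vertices at distance at most \<open>r\<close> and all edges between them.
\<close>

definition graph_ball :: "('a, 'b) pre_digraph \<Rightarrow> 'a \<Rightarrow> nat \<Rightarrow> ('a, 'b) pre_digraph" where
  "graph_ball T u r = T \<restriction> {v \<in> verts T. gdist T u v \<le> r}"

definition labelled_edge :: "lgraph \<Rightarrow> letter list \<Rightarrow> letter list \<Rightarrow> letter list \<Rightarrow> bool" where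
  "labelled_edge T x h y \<longleftrightarrow> (\<exists>a\<in>arcs T. tail T a = x \<and> snd a = h \<and> head T a = y)"

text \<open>
  Subgraphs of the Cayley graph have no parallel edges, so an isometry preserving labels and
  directions is determined by its action on vertices.
\<close>

definition pointed_iso :: "lgraph \<Rightarrow> letter list \<Rightarrow> lgraph \<Rightarrow> letter list \<Rightarrow> bool" where
  "pointed_iso A u B v \<longleftrightarrow>
    u \<in> verts A \<and>
    (\<exists>\<phi>. bij_betw \<phi> (verts A) (verts B) \<and> \<phi> u = v \<and>
      (\<forall>x\<in>verts A. \<forall>y\<in>verts A. gdist B (\<phi> x) (\<phi> y) = gdist A x y) \<and>
      (\<forall>x\<in>verts A. \<forall>y\<in>verts A. \<forall>h. labelled_edge A x h y \<longleftrightarrow> labelled_edge B (\<phi> x) h (\<phi> y)))"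

definition agree_radius :: "nat \<Rightarrow> lgraph \<Rightarrow> lgraph \<Rightarrow> nat" where
  "agree_radius n T T' =
    (GREATEST r. pointed_iso (graph_ball T \<one>\<^bsub>free_group n\<^esub> r) \<one>\<^bsub>free_group n\<^esub>
                             (graph_ball T' \<one>\<^bsub>free_group n\<^esub> r) \<one>\<^bsub>free_group n\<^esub>)"

definition tree_dist :: "nat \<Rightarrow> lgraph \<Rightarrow> lgraph \<Rightarrow> real" where
  "tree_dist n T T' = (if T = T' then 0 else exp (- real (agree_radius n T T')))"

definition tree_topology :: "nat \<Rightarrow> lgraph topology" where
  "tree_topology n = Metric_space.mtopology (tree_space n) (tree_dist n)"


section \<open>The partial action of the free group and orbit equivalence\<close>

definition act_defined :: "lgraph \<Rightarrow> letter list \<Rightarrow> bool" where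
  "act_defined T f \<longleftrightarrow> f \<in> verts T"

definition tree_act :: "nat \<Rightarrow> lgraph \<Rightarrow> letter list \<Rightarrow> lgraph" where
  "tree_act n T f = (THE T'. T' \<in> tree_space n \<and> pointed_iso T' \<one>\<^bsub>free_group n\<^esub> T f)"

definition tree_orbit :: "nat \<Rightarrow> lgraph \<Rightarrow> lgraph set" where
  "tree_orbit n T = {tree_act n T f | f. f \<in> carrier (free_group n) \<and> act_defined T f}"

definition orbit_equivalence ::
    "('g, 'm) monoid_scheme \<Rightarrow> 's set \<Rightarrow> nat \<Rightarrow> (('g \<Rightarrow> 's) \<Rightarrow> lgraph) \<Rightarrow> bool" where
  "orbit_equivalence G S n \<Phi> \<longleftrightarrow>
    (\<forall>\<sigma>\<in>bernoulli_space G S. \<Phi> ` shift_orbit G \<sigma> = tree_orbit n (\<Phi> \<sigma>))"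

end

theory Submission
  imports Defs
begin

text \<open>
  Read a configuration \<open>\<sigma>\<close> as a labelling of the Cayley graph of \<open>G\<close>: the edge leaving the identity
  in the positive direction \<open>g\<close> carries the free generator \<open>\<alpha> (g, \<sigma> \<one>)\<close>, and this pattern is
  transported to every vertex of \<open>G\<close> by the shift. Since \<open>\<alpha>\<close> is injective, the edges that start (or
  end) at a given vertex carry different generators, so a word over the free generators and their
  inverses can be followed in at most one way. The set \<^term>\<open>readable \<sigma>\<close> of reduced words that can be
  followed from the identity is closed under prefixes, and it spans a subtree \<^term>\<open>config_tree \<sigma>\<close> of
  the Cayley graph of the free group: the universal cover of the labelled Cayley graph of \<open>G\<close>,
  unfolded along its labels. This is the map \<open>\<Phi>\<^sub>\<alpha>\<close>.

  Following a word \<open>f\<close> from \<open>\<sigma>\<close> ends at some configuration \<open>\<tau>\<close> in the shift orbit of \<open>\<sigma>\<close>, and the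
  words that can be followed from \<open>\<tau>\<close> are exactly the translates by \<open>f\<inverse>\<close> of those that can be
  followed from \<open>\<sigma>\<close> (\<open>readable_translate\<close>). Hence the partial action of \<open>f\<close> moves the tree of
  \<open>\<sigma>\<close> to the tree of \<open>\<tau>\<close> (\<open>config_tree_run\<close>). The equations for the generators of \<open>G\<close> are the
  case of a one-letter word. As the generators of \<open>G\<close> can be crossed from any configuration, every point of the
  shift orbit is reached by some word, which gives the orbit equivalence.

  The tree determines \<open>\<sigma> \<one>\<close>, because this value is visible in the label of an edge at the root. By
  equivariance it determines the values of \<open>\<sigma>\<close> at all products of generators, so the map is injective.
  It is continuous because the words of length at most \<open>r\<close> inspect \<open>\<sigma>\<close> only on a finite set
  (\<open>finite_window\<close>). Since \<open>S\<close> is finite the Bernoulli space is compact, and a continuous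
  injection into a metric space is then an embedding.

  All this rests on a combinatorial description of the space of trees. A connected subgraph of the
  Cayley graph of a free group that contains the identity has a prefix-closed set of vertices and
  contains every edge between them (\<open>tree_space_is_word_graph\<close>), and the distance of a vertex to
  the root is its word length. Consequently an isomorphism of pointed subtrees is a left translation
  (\<open>pointed_iso_word_graph\<close>), two balls around the root are isomorphic iff they coincide, and
  the distance of trees is an ultrametric.
\<close>

section \<open>Multiplication of reduced words\<close>

lemma carrier_free_group_iff:
  "w \<in> carrier (free_group n) \<longleftrightarrow> reduced_word w \<and> fst ` set w \<subseteq> {..<n}"
  by (simp add: free_group_def)

lemma mult_free_group: "u \<otimes>\<^bsub>free_group n\<^esub> v = foldr push u v"
  by (simp add: free_group_def)

lemma one_free_group: "\<one>\<^bsub>free_group n\<^esub> = []"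
  by (simp add: free_group_def)

lemma inverse_in_carrier:
  "u \<in> carrier (free_group n) \<Longrightarrow> rev (map flip u) \<in> carrier (free_group n)"
  by (auto simp: carrier_free_group_iff reduced_inverse)

lemma inv_free_group:
  assumes "u \<in> carrier (free_group n)"
  shows "inv\<^bsub>free_group n\<^esub> u = rev (map flip u)"
proof -
  have "rev (map flip u) \<otimes>\<^bsub>free_group n\<^esub> u = \<one>\<^bsub>free_group n\<^esub>"
    using assms foldr_push_inverse[of "[]" u]
    by (simp add: mult_free_group one_free_group foldr_push_Nil carrier_free_group_iff)
  then show ?thesis
    using group.inv_equality[OF group_free_group] assms inverse_in_carrier by metis
qed

lemma foldr_push_in_carrier:
  assumes "u \<in> carrier (free_group n)" "v \<in> carrier (free_group n)"
  shows "foldr push u v \<in> carrier (free_group n)"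
  using monoid.m_closed[OF group.is_monoid[OF group_free_group] assms]
  by (simp add: mult_free_group)

lemma rev_map_flip_flip: "rev (map flip (rev (map flip u))) = u"
  by (simp add: rev_map comp_def)

lemma foldr_push_inverse_right:
  "reduced_word w \<Longrightarrow> foldr push u (foldr push (rev (map flip u)) w) = w"
  using foldr_push_inverse[of w "rev (map flip u)"] by (simp only: rev_map_flip_flip)

lemma reduced_appendD:
  assumes "reduced_word (u @ v)"
  shows "reduced_word u" "reduced_word v"
  using assms by (simp_all add: reduced_word_def successively_append_iff)

lemma reduced_snoc:
  "reduced_word (u @ [x]) \<longleftrightarrow> reduced_word u \<and> (u = [] \<or> last u \<noteq> flip x)"
  by (auto simp: reduced_word_def successively_append_iff)

text \<open>
  Right multiplication by a letter moves along one edge of the Cayley graph. As the last letter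
  alone decides whether it shortens or lengthens the word, the Cayley graph is a tree whose
  parent function is \<^const>\<open>butlast\<close>.
\<close>

lemma foldr_push_letter:
  assumes "reduced_word u"
  shows "foldr push u [x] = (if u \<noteq> [] \<and> last u = flip x then butlast u else u @ [x])"
proof (cases "u \<noteq> [] \<and> last u = flip x")
  case True
  then obtain u' where u: "u = u' @ [flip x]"
    by (metis append_butlast_last_id)
  then show ?thesis
    using assms foldr_push_Nil[of u'] by (auto dest: reduced_appendD)
next
  case False
  then have "reduced_word (u @ [x])"
    using assms by (auto simp: reduced_snoc)
  from foldr_push_Nil[OF this] show ?thesis
    using False by (simp only: if_False foldr_append foldr.simps comp_def id_def push.simps)
qed

lemma foldr_push_snoc:
  "reduced_word (u @ [x]) \<Longrightarrow> foldr push u [x] = u @ [x]"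
  using foldr_push_Nil[of "u @ [x]"] by simp

lemma foldr_push_cancel_letter:
  "reduced_word u \<Longrightarrow> foldr push (foldr push u [x]) [flip x] = u"
  using foldr_push_assoc[of "[flip x]" u "[x]"]
  by (simp add: foldr_push_Nil reduced_Cons)

lemma letter_in_carrier: "[x] \<in> carrier (free_group n) \<longleftrightarrow> fst x < n"
  by (simp add: carrier_free_group_iff reduced_Cons)

lemma free_gens_iff: "h \<in> free_gens n \<longleftrightarrow> (\<exists>x. h = [x] \<and> snd x \<and> fst x < n)"
  by (force simp: free_gens_def)


section \<open>Full subgraphs of the Cayley graph\<close>

abbreviation word_graph :: "nat \<Rightarrow> letter list set \<Rightarrow> lgraph" where
  "word_graph n V \<equiv> cayley n \<restriction> V"

lemma word_graph_simps:
  "verts (word_graph n V) = V"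
  "tail (word_graph n V) = fst"
  "head (word_graph n V) (g, h) = foldr push g h"
  "(g, h) \<in> arcs (word_graph n V) \<longleftrightarrow>
     g \<in> carrier (free_group n) \<and> h \<in> free_gens n \<and> g \<in> V \<and> foldr push g h \<in> V"
  "tail (cayley n) = fst"
  "head (cayley n) (g, h) = foldr push g h"
  "arcs (cayley n) = carrier (free_group n) \<times> free_gens n"
  by (auto simp: induce_subgraph_def cayley_def mult_free_group)

lemma word_graph_inject: "word_graph n V = word_graph n W \<longleftrightarrow> V = W"
  by (metis word_graph_simps(1))

lemma labelled_edge_word_graph:
  assumes "V \<subseteq> carrier (free_group n)"
  shows "labelled_edge (word_graph n V) x h y \<longleftrightarrow>
    x \<in> V \<and> h \<in> free_gens n \<and> y \<in> V \<and> y = foldr push x h"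
  using assms by (force simp: labelled_edge_def word_graph_simps)

text \<open>
  An undirected edge path in a full subgraph is determined by its start and the letters that it
  multiplies by. Working with these letters removes arcs, labels and directions from the arguments
  about distances, translations and backtracking.
\<close>

fun word_path :: "nat \<Rightarrow> letter list set \<Rightarrow> letter list \<Rightarrow> letter list \<Rightarrow> letter list \<Rightarrow> bool" where
  "word_path n V u [] v \<longleftrightarrow> u \<in> V \<and> u = v"
| "word_path n V u (x # w) v \<longleftrightarrow> u \<in> V \<and> fst x < n \<and> word_path n V (foldr push u [x]) w v"

fun arc_letter :: "(letter list \<times> letter list) \<times> bool \<Rightarrow> letter" where
  "arc_letter ((g, h), b) = (if b then hd h else flip (hd h))"

text \<open>
  The arc with a sense of traversal that leads from \<open>u\<close> to \<open>ux\<close>. An inverse generator is a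
  traversal against the direction of the arc, which is then based at the far end.
\<close>

definition letter_arc :: "letter list \<Rightarrow> letter \<Rightarrow> (letter list \<times> letter list) \<times> bool" where
  "letter_arc u x = (if snd x then ((u, [x]), True) else ((foldr push u [x], [flip x]), False))"

text \<open>
  Two consecutive inverse letters retrace one arc. This is what turns absence of backtracking into
  reducedness of a word.
\<close>

lemma letter_arc_reverse:
  assumes "reduced_word u"
  shows "letter_arc (foldr push u [x]) (flip x) =
    (fst (letter_arc u x), \<not> snd (letter_arc u x))"
  using foldr_push_cancel_letter[OF assms, of x]
  by (cases x) (auto simp: letter_arc_def flip_def)

lemma letter_arc:
  assumes "V \<subseteq> carrier (free_group n)" "u \<in> V" "foldr push u [x] \<in> V" "fst x < n"
  shows "letter_arc u x \<in> arcs (two_way (word_graph n V))"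
    and "tail (two_way (word_graph n V)) (letter_arc u x) = u"
    and "head (two_way (word_graph n V)) (letter_arc u x) = foldr push u [x]"
    and "arc_letter (letter_arc u x) = x"
proof -
  have "reduced_word u"
    using assms by (auto simp: carrier_free_group_iff)
  note c = foldr_push_cancel_letter[OF this, of x]
  have "u \<in> carrier (free_group n)" "foldr push u [x] \<in> carrier (free_group n)"
    using assms by auto
  then show "letter_arc u x \<in> arcs (two_way (word_graph n V))"
    using assms c
    by (auto simp: letter_arc_def two_way_def word_graph_simps free_gens_iff flip_def)
  show "tail (two_way (word_graph n V)) (letter_arc u x) = u"
    "head (two_way (word_graph n V)) (letter_arc u x) = foldr push u [x]"
    "arc_letter (letter_arc u x) = x"
    using c by (simp_all add: letter_arc_def two_way_def word_graph_simps)
qed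

lemma arc_of_word_graph:
  assumes V: "V \<subseteq> carrier (free_group n)" and a: "a \<in> arcs (two_way (word_graph n V))"
  defines "u \<equiv> tail (two_way (word_graph n V)) a"
  shows "u \<in> V" and "head (two_way (word_graph n V)) a = foldr push u [arc_letter a]"
    and "foldr push u [arc_letter a] \<in> V"
    and "fst (arc_letter a) < n" and "a = letter_arc u (arc_letter a)"
proof -
  obtain g x b where ab: "a = ((g, [x]), b)" "snd x" "fst x < n"
    and g: "g \<in> V" "foldr push g [x] \<in> V" "g \<in> carrier (free_group n)"
    using a by (cases a) (auto simp: two_way_def word_graph_simps free_gens_iff)
  have "reduced_word g"
    using g by (simp add: carrier_free_group_iff)
  note c = foldr_push_cancel_letter[OF this, of x]
  show "u \<in> V" "head (two_way (word_graph n V)) a = foldr push u [arc_letter a]"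
    "foldr push u [arc_letter a] \<in> V"
    "fst (arc_letter a) < n" "a = letter_arc u (arc_letter a)"
    using ab g c unfolding u_def
    by (cases x; auto simp: two_way_def word_graph_simps letter_arc_def flip_def)+
qed

lemma awalk_imp_word_path:
  assumes V: "V \<subseteq> carrier (free_group n)"
  shows "pre_digraph.awalk (two_way (word_graph n V)) u p v \<Longrightarrow>
    word_path n V u (map arc_letter p) v"
proof (induction p arbitrary: u)
  case Nil
  then show ?case
    by (auto simp: pre_digraph.awalk_def pre_digraph.cas.simps two_way_def)
next
  case (Cons a p)
  let ?T = "two_way (word_graph n V)"
  have a: "a \<in> arcs ?T" "tail ?T a = u" and p: "set p \<subseteq> arcs ?T" "pre_digraph.cas ?T (head ?T a) p v"
    using Cons.prems by (auto simp: pre_digraph.awalk_def pre_digraph.cas.simps)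
  note arc = arc_of_word_graph[OF V a(1), unfolded a(2)]
  have "pre_digraph.awalk ?T (head ?T a) p v"
    using arc p by (simp add: pre_digraph.awalk_def two_way_def word_graph_simps)
  then show ?case
    using Cons.IH arc by simp
qed

lemma word_path_imp_awalk:
  assumes V: "V \<subseteq> carrier (free_group n)"
  shows "word_path n V u w v \<Longrightarrow>
    \<exists>p. pre_digraph.awalk (two_way (word_graph n V)) u p v \<and> map arc_letter p = w"
proof (induction w arbitrary: u)
  case Nil
  then show ?case
    by (auto simp: pre_digraph.awalk_def pre_digraph.cas.simps two_way_def)
next
  case (Cons x w)
  let ?T = "two_way (word_graph n V)"
  obtain p where p: "pre_digraph.awalk ?T (foldr push u [x]) p v" "map arc_letter p = w"
    using Cons by auto
  then have "foldr push u [x] \<in> V"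
    by (simp add: pre_digraph.awalk_def two_way_def word_graph_simps)
  then have arc: "letter_arc u x \<in> arcs ?T" "tail ?T (letter_arc u x) = u"
    "head ?T (letter_arc u x) = foldr push u [x]" "arc_letter (letter_arc u x) = x"
    using letter_arc[OF V, of u x] Cons.prems by auto
  have "pre_digraph.awalk ?T u (letter_arc u x # p) v"
    using p arc Cons.prems
    by (simp add: pre_digraph.awalk_def pre_digraph.cas.simps) (simp add: two_way_def)
  then show ?case
    using p arc by (intro exI[of _ "letter_arc u x # p"]) simp
qed

lemma gdist_word_graph:
  assumes "V \<subseteq> carrier (free_group n)"
  shows "gdist (word_graph n V) u v = (LEAST k. \<exists>w. word_path n V u w v \<and> length w = k)"
proof -
  have "(\<exists>p. pre_digraph.awalk (two_way (word_graph n V)) u p v \<and> length p = k) \<longleftrightarrow>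
        (\<exists>w. word_path n V u w v \<and> length w = k)" for k
    using awalk_imp_word_path[OF assms] word_path_imp_awalk[OF assms] by (metis length_map)
  then show ?thesis
    by (simp add: gdist_def)
qed

text \<open>
  Paths are built by right multiplication, so left translations preserve them.
\<close>

lemma word_path_translate:
  assumes "V \<subseteq> carrier (free_group n)" "f \<in> carrier (free_group n)" "u \<in> carrier (free_group n)"
    "v \<in> carrier (free_group n)"
  shows "word_path n (foldr push f ` V) (foldr push f u) w (foldr push f v) \<longleftrightarrow> word_path n V u w v"
  using assms(3)
proof (induction w arbitrary: u)
  have inj: "foldr push f a = foldr push f b \<longleftrightarrow> a = b"
    if "a \<in> carrier (free_group n)" "b \<in> carrier (free_group n)" for a b
    using that foldr_push_inverse by (metis carrier_free_group_iff)
  have mem: "foldr push f u \<in> foldr push f ` V \<longleftrightarrow> u \<in> V"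
    if "u \<in> carrier (free_group n)" for u
    using inj[OF that] assms(1) by auto
  {
    case Nil
    then show ?case
      using inj[OF Nil assms(4)] mem[OF Nil] by simp
  next
    case (Cons x w)
    have "foldr push (foldr push f u) [x] = foldr push f (foldr push u [x])"
      by (rule foldr_push_assoc) (simp add: reduced_Cons)
    moreover have "foldr push u [x] \<in> carrier (free_group n)" if "fst x < n"
      using Cons.prems that foldr_push_in_carrier letter_in_carrier by blast
    ultimately show ?case
      using Cons.IH[of "foldr push u [x]"] mem[OF Cons.prems] by auto
  }
qed

lemma gdist_translate:
  assumes "V \<subseteq> carrier (free_group n)" "f \<in> carrier (free_group n)" "u \<in> V" "v \<in> V"
  shows "gdist (word_graph n (foldr push f ` V)) (foldr push f u) (foldr push f v) =
    gdist (word_graph n V) u v"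
proof -
  have "foldr push f ` V \<subseteq> carrier (free_group n)"
    using assms foldr_push_in_carrier by blast
  moreover have "u \<in> carrier (free_group n)" "v \<in> carrier (free_group n)"
    using assms by auto
  ultimately show ?thesis
    using assms by (simp add: gdist_word_graph word_path_translate)
qed

lemma word_path_endpoint:
  "word_path n V u w v \<Longrightarrow> reduced_word u \<Longrightarrow> v = foldr push u (foldr push w [])"
proof (induction w arbitrary: u)
  case Nil
  then show ?case by (simp add: foldr_push_Nil)
next
  case (Cons x w)
  have r: "reduced_word (foldr push u [x])"
    by (rule reduced_foldr_push) (simp add: reduced_Cons)
  have "v = foldr push (foldr push u [x]) (foldr push w [])"
    using Cons r by auto
  also have "\<dots> = foldr push u (foldr push [x] (foldr push w []))"
    by (rule foldr_push_assoc) (simp add: reduced_foldr_push)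
  finally show ?case by simp
qed

lemma word_path_length:
  "word_path n V u w v \<Longrightarrow> reduced_word u \<Longrightarrow> length v \<le> length u + length w"
proof (induction w arbitrary: u)
  case (Cons x w)
  have r: "reduced_word (foldr push u [x])"
    by (rule reduced_foldr_push) (simp add: reduced_Cons)
  have "length (foldr push u [x]) \<le> Suc (length u)"
    using Cons.prems(2) by (auto simp: foldr_push_letter)
  moreover have "length v \<le> length (foldr push u [x]) + length w"
    using Cons r by simp
  ultimately show ?case by simp
qed simp

lemma word_path_snoc:
  "word_path n V u w v \<Longrightarrow> fst x < n \<Longrightarrow> foldr push v [x] \<in> V \<Longrightarrow>
    word_path n V u (w @ [x]) (foldr push v [x])"
  by (induction w arbitrary: u) auto


section \<open>Subtrees containing the identity as prefix-closed sets of words\<close>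

definition prefix_closed :: "nat \<Rightarrow> letter list set \<Rightarrow> bool" where
  "prefix_closed n V \<longleftrightarrow>
    V \<subseteq> carrier (free_group n) \<and> [] \<in> V \<and> (\<forall>u x. u @ [x] \<in> V \<longrightarrow> u \<in> V)"

lemma prefix_closedD:
  assumes "prefix_closed n V"
  shows "V \<subseteq> carrier (free_group n)" "[] \<in> V" "u @ [x] \<in> V \<Longrightarrow> u \<in> V"
    and "u @ [x] \<in> V \<Longrightarrow> foldr push u [x] = u @ [x]"
    and "u @ [x] \<in> V \<Longrightarrow> fst x < n"
proof -
  show "V \<subseteq> carrier (free_group n)" "[] \<in> V" "u @ [x] \<in> V \<Longrightarrow> u \<in> V"
    using assms unfolding prefix_closed_def by blast+
  then have "reduced_word (u @ [x]) \<and> fst x < n" if "u @ [x] \<in> V"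
    using that by (auto simp: carrier_free_group_iff subset_iff)
  then show "u @ [x] \<in> V \<Longrightarrow> foldr push u [x] = u @ [x]" "u @ [x] \<in> V \<Longrightarrow> fst x < n"
    using foldr_push_snoc by blast+
qed

lemma word_path_from_root:
  assumes "prefix_closed n V"
  shows "v \<in> V \<Longrightarrow> word_path n V [] v v"
proof (induction v rule: rev_induct)
  case (snoc x v)
  note * = prefix_closedD[OF assms]
  show ?case
    using snoc *(3-5)[OF snoc.prems] word_path_snoc[of n V "[]" v v x] by simp
qed simp

text \<open>
  The prefixes of \<open>v\<close> form a path of length \<^term>\<open>length v\<close>, and no path is shorter because a single
  letter changes the length of a reduced word by one.
\<close>

lemma gdist_from_root:
  assumes V: "prefix_closed n V" and "v \<in> V"
  shows "gdist (word_graph n V) [] v = length v"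
  unfolding gdist_word_graph[OF prefix_closedD(1)[OF V]]
proof (rule Least_equality)
  show "\<exists>w. word_path n V [] w v \<and> length w = length v"
    using word_path_from_root[OF assms] by blast
qed (use word_path_length in force)

abbreviation truncate :: "letter list set \<Rightarrow> nat \<Rightarrow> letter list set" where
  "truncate V r \<equiv> {v \<in> V. length v \<le> r}"

lemma prefix_closed_truncate: "prefix_closed n V \<Longrightarrow> prefix_closed n (truncate V r)"
  by (auto simp: prefix_closed_def)

lemma graph_ball_word_graph:
  assumes "prefix_closed n V"
  shows "graph_ball (word_graph n V) [] r = word_graph n (truncate V r)"
proof -
  have "{v \<in> verts (word_graph n V). gdist (word_graph n V) [] v \<le> r} = truncate V r"
    using gdist_from_root[OF assms] by (auto simp: word_graph_simps)
  then show ?thesis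
    by (auto simp: graph_ball_def induce_subgraph_def)
qed

text \<open>
  A map that preserves labels and directions of edges commutes with right multiplication by the
  letters that stay inside the tree. Induction along the prefixes of a word then shows that such a
  map is the left translation by the image of the root.
\<close>

lemma pointed_iso_word_graph:
  assumes V: "prefix_closed n V" and W: "W \<subseteq> carrier (free_group n)"
    and f: "f \<in> carrier (free_group n)"
  shows "pointed_iso (word_graph n V) [] (word_graph n W) f \<longleftrightarrow> W = foldr push f ` V"
proof
  note VD = prefix_closedD[OF V]
  assume "pointed_iso (word_graph n V) [] (word_graph n W) f"
  then obtain \<phi> where bij: "bij_betw \<phi> V W" and root: "\<phi> [] = f"
    and edge: "\<And>x h y. x \<in> V \<Longrightarrow> y \<in> V \<Longrightarrow>
      labelled_edge (word_graph n V) x h y \<longleftrightarrow> labelled_edge (word_graph n W) (\<phi> x) h (\<phi> y)"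
    by (auto simp: pointed_iso_def word_graph_simps)
  have "\<phi> v = foldr push f v" if "v \<in> V" for v
    using that
  proof (induction v rule: rev_induct)
    case Nil
    then show ?case
      using root f by (simp add: carrier_free_group_iff foldr_push_Nil)
  next
    case (snoc x v)
    have v: "v \<in> V" "foldr push v [x] = v @ [x]" "fst x < n"
      using VD(3-5)[OF snoc.prems] by auto
    have red: "reduced_word v" "reduced_word (\<phi> (v @ [x]))"
      using v VD(1) W bij snoc.prems by (auto simp: carrier_free_group_iff bij_betw_def)
    have "\<phi> (v @ [x]) = foldr push (\<phi> v) [x]"
    proof (cases "snd x")
      case True
      then have "labelled_edge (word_graph n V) v [x] (v @ [x])"
        using v snoc.prems VD(1) by (auto simp: labelled_edge_word_graph free_gens_iff)
      then show ?thesis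
        using edge[OF v(1) snoc.prems] W by (simp add: labelled_edge_word_graph)
    next
      case False
      have "foldr push (v @ [x]) [flip x] = v"
        using foldr_push_cancel_letter[OF red(1), of x] v(2) by simp
      then have "labelled_edge (word_graph n V) (v @ [x]) [flip x] v"
        using False v snoc.prems VD(1)
        by (auto simp: labelled_edge_word_graph free_gens_iff flip_def)
      then have "\<phi> v = foldr push (\<phi> (v @ [x])) [flip x]"
        using edge[OF snoc.prems v(1)] W by (simp add: labelled_edge_word_graph)
      then show ?thesis
        using foldr_push_cancel_letter[OF red(2), of "flip x"] by simp
    qed
    also have "\<dots> = foldr push f (foldr push v [x])"
      using snoc.IH[OF v(1)] foldr_push_assoc[of "[x]" f v] by (simp add: reduced_Cons)
    finally show ?case
      using v(2) by simp
  qed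
  then have "\<phi> ` V = foldr push f ` V" by simp
  then show "W = foldr push f ` V"
    using bij by (simp add: bij_betw_def)
next
  note VD = prefix_closedD[OF V]
  assume W_eq: "W = foldr push f ` V"
  have red: "reduced_word v" if "v \<in> V" for v
    using that VD(1) by (auto simp: carrier_free_group_iff)
  have inj: "foldr push f u = foldr push f v \<longleftrightarrow> u = v" if "reduced_word u" "reduced_word v" for u v
    using that foldr_push_inverse by metis
  have bij: "bij_betw (foldr push f) V W"
    unfolding W_eq bij_betw_def inj_on_def using inj red by simp
  have "labelled_edge (word_graph n V) x h y \<longleftrightarrow>
        labelled_edge (word_graph n W) (foldr push f x) h (foldr push f y)"
    if xy: "x \<in> V" "y \<in> V" for x y h
  proof -
    have "foldr push (foldr push f x) h = foldr push f (foldr push x h)" "reduced_word (foldr push x h)"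
      if "h \<in> free_gens n"
      using that by (auto simp: free_gens_iff reduced_Cons foldr_push_assoc reduced_foldr_push)
    then show ?thesis
      using xy inj red[of y] W_eq
      by (auto simp: labelled_edge_word_graph[OF VD(1)]
          labelled_edge_word_graph[OF W[unfolded W_eq]])
  qed
  moreover have "foldr push f [] = f"
    using f by (simp add: foldr_push_Nil carrier_free_group_iff)
  moreover have "gdist (word_graph n W) (foldr push f x) (foldr push f y) = gdist (word_graph n V) x y"
    if "x \<in> V" "y \<in> V" for x y
    using gdist_translate[OF VD(1) f that] by (simp only: W_eq)
  ultimately show "pointed_iso (word_graph n V) [] (word_graph n W) f"
    unfolding pointed_iso_def word_graph_simps using VD(2) bij by blast
qed

text \<open>
  Without backtracking the letters of a closed walk form a reduced word, and a walk multiplies its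
  start by this word. If the walk is closed the word is therefore trivial in the free group, hence
  empty.
\<close>

lemma acyclic_word_graph:
  assumes V: "V \<subseteq> carrier (free_group n)"
  shows "acyclic_graph (word_graph n V)"
  unfolding acyclic_graph_def
proof (intro allI impI, elim conjE)
  fix u p
  let ?T = "two_way (word_graph n V)"
  assume walk: "pre_digraph.awalk ?T u p u"
    and nb: "successively (\<lambda>(a, b) (a', b'). \<not> (a' = a \<and> b' = (\<not> b))) p"
  have "successively (\<lambda>x y. y \<noteq> flip x) (map arc_letter p)"
    if "set p \<subseteq> arcs ?T" "pre_digraph.cas ?T u p v" for u v
    using that nb
  proof (induction p arbitrary: u)
    case (Cons a p)
    show ?case
    proof (cases p)
      case (Cons a' q)
      have arcs: "a \<in> arcs ?T" "a' \<in> arcs ?T" and joint: "tail ?T a' = head ?T a"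
        using Cons Cons.prems by (auto simp: pre_digraph.cas.simps)
      note 1 = arc_of_word_graph[OF V arcs(1)] and 2 = arc_of_word_graph[OF V arcs(2)]
      have "arc_letter a' \<noteq> flip (arc_letter a)"
      proof
        assume eq: "arc_letter a' = flip (arc_letter a)"
        define x where "x = arc_letter a"
        have "reduced_word (tail ?T a)"
          using 1(1) V by (auto simp: carrier_free_group_iff)
        from letter_arc_reverse[OF this, of x] have "fst a' = fst a" "snd a' = (\<not> snd a)"
          using 1(2,5) 2(5) eq joint by (metis fst_conv snd_conv x_def)+
        then show False
          using Cons.prems(3) \<open>p = a' # q\<close> by (auto simp: case_prod_beta)
      qed
      moreover have "successively (\<lambda>x y. y \<noteq> flip x) (map arc_letter p)"
        using Cons.IH[of "head ?T a"] Cons.prems \<open>p = a' # q\<close>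
        by (auto simp: pre_digraph.cas.simps case_prod_beta)
      ultimately show ?thesis
        using \<open>p = a' # q\<close> by simp
    qed simp
  qed simp
  then have red: "reduced_word (map arc_letter p)"
    using walk by (auto simp: reduced_word_def pre_digraph.awalk_def)
  have "reduced_word u"
    using walk V by (auto simp: pre_digraph.awalk_def two_way_def carrier_free_group_iff)
  then have "foldr push u [] = foldr push u (map arc_letter p)"
    using word_path_endpoint[OF awalk_imp_word_path[OF V walk]] red by (simp add: foldr_push_Nil)
  then have "map arc_letter p = []"
    using foldr_push_inverse red reduced_Nil by metis
  then show "p = []" by simp
qed

lemma connected_word_graph:
  assumes V: "prefix_closed n V"
  shows "Digraph_Component.connected (word_graph n V)"
proof -
  note VD = prefix_closedD[OF V]
  let ?R = "rtrancl_on V (parcs (mk_symmetric (word_graph n V)))"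
  have edge: "(u, foldr push u [x]) \<in> parcs (mk_symmetric (word_graph n V))"
    if "u \<in> V" "foldr push u [x] \<in> V" "fst x < n" for u x
    using letter_arc(1-3)[OF VD(1) that]
    by (force simp: two_way_def mk_symmetric_def split: if_splits)
  have root: "([], v) \<in> ?R" if "v \<in> V" for v
    using that
  proof (induction v rule: rev_induct)
    case (snoc x v)
    then show ?case
      using VD(3-5)[OF snoc.prems] edge[of v x] by (auto intro: rtrancl_on_into_rtrancl_on)
  qed (simp add: VD)
  have "sym (parcs (mk_symmetric (word_graph n V)))"
    by (auto simp: sym_def mk_symmetric_def)
  then have "sym ?R"
    by (rule rtrancl_on_sym)
  then have "(u, v) \<in> ?R" if "u \<in> V" "v \<in> V" for u v
    using root that by (meson rtrancl_on_trans symD)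
  then show ?thesis
    using VD(2) by (auto simp: connected_def strongly_connected_def reachable_def word_graph_simps)
qed

text \<open>
  By induction along a walk from the root, the subgraph contains all prefixes of every visited vertex
  together with the edges joining them. Since any edge of the Cayley graph joins a word to its
  longest proper prefix, no edge between two vertices of the subgraph can then be missing.
\<close>

lemma tree_space_is_word_graph:
  assumes T: "T \<in> tree_space n"
  obtains V where "prefix_closed n V" "infinite V" "T = word_graph n V"
proof -
  have sub: "verts T \<subseteq> carrier (free_group n)" "arcs T \<subseteq> carrier (free_group n) \<times> free_gens n"
    and ends: "tail T = fst" "head T = (\<lambda>(g, h). foldr push g h)"
    and wf: "wf_digraph T"
    and inf: "infinite (verts T)" and conn: "Digraph_Component.connected T" and root: "[] \<in> verts T"
    using T by (auto simp: tree_space_def subgraph_def cayley_def compatible_def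
      one_free_group mult_free_group)
  have adj: "\<exists>x. v' = foldr push v [x] \<and> fst (letter_arc v x) \<in> arcs T"
    if edge: "(v, v') \<in> parcs (mk_symmetric T)" for v v'
  proof -
    obtain g h where gh: "(g, h) \<in> arcs T"
      "(v, v') = (g, foldr push g h) \<or> (v, v') = (foldr push g h, g)"
      using edge ends by (auto simp: mk_symmetric_def)
    then have "h \<in> free_gens n"
      using sub by blast
    then obtain x where x: "h = [x]" "snd x"
      using free_gens_iff by blast
    have "reduced_word g"
      using gh sub by (auto simp: carrier_free_group_iff)
    note c = foldr_push_cancel_letter[OF this, of x]
    show ?thesis
      using gh(2)
    proof
      assume "(v, v') = (g, foldr push g h)"
      then show ?thesis
        using gh x by (intro exI[of _ x]) (auto simp: letter_arc_def)
    next
      assume "(v, v') = (foldr push g h, g)"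
      then show ?thesis
        using gh x c by (intro exI[of _ "flip x"]) (cases x; auto simp: letter_arc_def flip_def)
    qed
  qed
  have prefixes: "u \<in> verts T \<and> fst (letter_arc u x) \<in> arcs T"
    if "v \<in> verts T" "v = u @ x # w" for u x v w
  proof -
    have "([], v) \<in> rtrancl_on (verts T) (parcs (mk_symmetric T))"
      using conn root that(1) by (auto simp: connected_def strongly_connected_def reachable_def)
    then have "\<forall>u x w. v = u @ x # w \<longrightarrow> u \<in> verts T \<and> fst (letter_arc u x) \<in> arcs T"
    proof (induction rule: rtrancl_on_induct)
      case (step v v')
      obtain y where y: "v' = foldr push v [y]" "fst (letter_arc v y) \<in> arcs T"
        using adj step by blast
      have "reduced_word v"
        using step sub by (auto simp: carrier_free_group_iff)
      then consider "v = v' @ [flip y]" | "v' = v @ [y]"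
        using y(1) by (auto simp: foldr_push_letter split: if_splits)
          (metis append_butlast_last_id)
      then show ?case
      proof cases
        case 1
        show ?thesis
        proof (intro allI impI)
          fix u x w assume "v' = u @ x # w"
          then have "v = u @ x # (w @ [flip y])"
            using 1 by simp
          then show "u \<in> verts T \<and> fst (letter_arc u x) \<in> arcs T"
            using step by blast
        qed
      next
        case 2
        show ?thesis
        proof (intro allI impI)
          fix u x w assume eq: "v' = u @ x # w"
          show "u \<in> verts T \<and> fst (letter_arc u x) \<in> arcs T"
          proof (cases w rule: rev_cases)
            case Nil
            then show ?thesis
              using eq 2 y step by simp
          next
            case (snoc w' z)
            then have "v = u @ x # w'"
              using eq 2 by simp
            then show ?thesis
              using step by blast
          qed
        qed
      qed
    qed simp
    then show ?thesis
      using that by blast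
  qed
  have closed: "prefix_closed n (verts T)"
    using sub root prefixes by (auto simp: prefix_closed_def)
  have "(g, h) \<in> arcs T \<longleftrightarrow> (g, h) \<in> arcs (word_graph n (verts T))" for g h
  proof
    assume "(g, h) \<in> arcs T"
    then show "(g, h) \<in> arcs (word_graph n (verts T))"
      using sub wf_digraph.tail_in_verts[OF wf] wf_digraph.head_in_verts[OF wf] ends
      by (fastforce simp: word_graph_simps)
  next
    assume "(g, h) \<in> arcs (word_graph n (verts T))"
    then obtain x where x: "h = [x]" "snd x" and g: "g \<in> verts T" "foldr push g [x] \<in> verts T"
      by (auto simp: word_graph_simps free_gens_iff)
    have "reduced_word g"
      using g sub by (auto simp: carrier_free_group_iff)
    note c = foldr_push_cancel_letter[OF this, of x]
    consider "g = foldr push g [x] @ [flip x]" | "foldr push g [x] = g @ [x]"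
      using foldr_push_letter[OF \<open>reduced_word g\<close>, of x] by (metis append_butlast_last_id)
    then show "(g, h) \<in> arcs T"
    proof cases
      case 1
      then have "fst (letter_arc (foldr push g [x]) (flip x)) \<in> arcs T"
        using prefixes[OF g(1), of "foldr push g [x]" "flip x" "[]"] by simp
      then show ?thesis
        using x c by (cases x) (simp add: letter_arc_def flip_def)
    next
      case 2
      then have "fst (letter_arc g x) \<in> arcs T"
        using prefixes[OF g(2), of g x "[]"] by simp
      then show ?thesis
        using x by (simp add: letter_arc_def)
    qed
  qed
  then have "arcs T = arcs (word_graph n (verts T))" by auto
  then have "T = word_graph n (verts T)"
    using ends by (intro pre_digraph.equality ext) (auto simp: word_graph_simps)
  then show ?thesis
    using that closed inf by blast
qed

lemma word_graph_in_tree_space: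
  assumes "prefix_closed n V" "infinite V"
  shows "word_graph n V \<in> tree_space n"
proof -
  note VD = prefix_closedD[OF assms(1)]
  have "subgraph (word_graph n V) (cayley n)"
    using VD(1) wf_digraph_cayley[of n]
    by (intro induced_imp_subgraph wf_digraph.induced_induce) (auto simp: cayley_def)
  then show ?thesis
    using VD assms acyclic_word_graph connected_word_graph
    by (simp add: tree_space_def one_free_group)
qed


section \<open>The ultrametric on the space of pointed trees\<close>

text \<open>
  Symmetry is shown for arbitrary graphs, since the axioms of a metric space ask for symmetry of the
  distance outside of the carrier as well.
\<close>

lemma pointed_iso_sym:
  assumes "pointed_iso A u B v"
  shows "pointed_iso B v A u"
proof -
  obtain \<phi> where u: "u \<in> verts A" "\<phi> u = v" and bij: "bij_betw \<phi> (verts A) (verts B)"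
    and dist: "\<And>x y. x \<in> verts A \<Longrightarrow> y \<in> verts A \<Longrightarrow> gdist B (\<phi> x) (\<phi> y) = gdist A x y"
    and edge: "\<And>x y h. x \<in> verts A \<Longrightarrow> y \<in> verts A \<Longrightarrow>
      labelled_edge A x h y \<longleftrightarrow> labelled_edge B (\<phi> x) h (\<phi> y)"
    using assms unfolding pointed_iso_def by blast
  define \<psi> where "\<psi> = inv_into (verts A) \<phi>"
  have \<psi>: "bij_betw \<psi> (verts B) (verts A)" "\<psi> v = u"
    using bij u unfolding \<psi>_def by (auto intro: bij_betw_inv_into simp: bij_betw_inv_into_left)
  have inverse: "\<psi> x \<in> verts A" "\<phi> (\<psi> x) = x" if "x \<in> verts B" for x
    using that \<psi>(1) bij by (auto simp: \<psi>_def bij_betw_apply bij_betw_inv_into_right)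
  show ?thesis
    unfolding pointed_iso_def
  proof (intro conjI exI[of _ \<psi>] ballI allI)
    show "v \<in> verts B"
      using u bij by (auto simp: bij_betw_apply)
    fix x y h assume "x \<in> verts B" "y \<in> verts B"
    then show "gdist A (\<psi> x) (\<psi> y) = gdist B x y"
      "labelled_edge B x h y \<longleftrightarrow> labelled_edge A (\<psi> x) h (\<psi> y)"
      using dist[of "\<psi> x" "\<psi> y"] edge[of "\<psi> x" "\<psi> y" h] inverse by simp_all
  qed (use \<psi> in blast)+
qed

lemma pointed_iso_balls:
  assumes "prefix_closed n V" "prefix_closed n W"
  shows "pointed_iso (graph_ball (word_graph n V) [] r) [] (graph_ball (word_graph n W) [] r) [] \<longleftrightarrow>
    truncate V r = truncate W r"
proof -
  have "foldr push [] = (\<lambda>w. w)" by auto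
  moreover have "truncate W r \<subseteq> carrier (free_group n)" "[] \<in> carrier (free_group n)"
    using prefix_closedD(1,2)[OF assms(2)] by auto
  ultimately show ?thesis
    using pointed_iso_word_graph[OF prefix_closed_truncate[OF assms(1)], of "truncate W r" "[]" r]
      assms by (auto simp: graph_ball_word_graph)
qed

lemma truncate_eq_mono:
  assumes "truncate V s = truncate W s" "r \<le> s"
  shows "truncate V r = truncate W r"
proof -
  have "v \<in> V \<longleftrightarrow> v \<in> W" if "length v \<le> s" for v
    using assms(1) that by blast
  then show ?thesis
    using assms(2) by auto
qed

text \<open>
  The radii on which two distinct trees agree form a nonempty bounded initial segment: agreement on
  a ball restricts to smaller balls, radius \<open>0\<close> only sees the root, and a word in just one of the
  trees bounds the radius by its length. So the \<open>GREATEST\<close> in \<^const>\<open>agree_radius\<close> exists.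
\<close>

lemma le_agree_radius_iff:
  assumes "prefix_closed n V" "prefix_closed n W" "V \<noteq> W"
  shows "r \<le> agree_radius n (word_graph n V) (word_graph n W) \<longleftrightarrow> truncate V r = truncate W r"
proof -
  let ?P = "\<lambda>r. truncate V r = truncate W r"
  have eq: "agree_radius n (word_graph n V) (word_graph n W) = Greatest ?P"
    using assms by (simp add: agree_radius_def one_free_group pointed_iso_balls)
  obtain w where "(w \<in> V) \<noteq> (w \<in> W)"
    using assms(3) by blast
  then have bound: "s \<le> length w" if "?P s" for s
    using that by (metis (mono_tags, lifting) mem_Collect_eq nle_le)
  have "?P 0"
    using prefix_closedD(2) assms(1,2) by auto
  then have "?P (Greatest ?P)"
    using GreatestI_nat[of ?P] bound by blast
  moreover have "s \<le> Greatest ?P" if "?P s" for s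
    using Greatest_le_nat[of ?P s "length w"] that bound by blast
  ultimately show ?thesis
    unfolding eq using truncate_eq_mono by blast
qed

lemma tree_dist_le:
  assumes "prefix_closed n V" "prefix_closed n W" "truncate V r = truncate W r"
  shows "tree_dist n (word_graph n V) (word_graph n W) \<le> exp (- real r)"
  using le_agree_radius_iff[OF assms(1,2), of r] assms(3)
  by (cases "V = W") (auto simp: tree_dist_def word_graph_inject)

lemma Metric_space_tree_dist: "Metric_space (tree_space n) (tree_dist n)"
proof
  fix T T' :: lgraph
  show "0 \<le> tree_dist n T T'" "tree_dist n T T' = 0 \<longleftrightarrow> T = T'"
    by (simp_all add: tree_dist_def)
  have "agree_radius n T T' = agree_radius n T' T"
    unfolding agree_radius_def
    by (intro arg_cong[where f = Greatest] ext) (blast intro: pointed_iso_sym)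
  then show "tree_dist n T T' = tree_dist n T' T"
    by (simp add: tree_dist_def)
next
  fix T T' T'' assume T: "T \<in> tree_space n" "T' \<in> tree_space n" "T'' \<in> tree_space n"
  obtain V V' V'' where pc: "prefix_closed n V" "prefix_closed n V'" "prefix_closed n V''"
    and eq: "T = word_graph n V" "T' = word_graph n V'" "T'' = word_graph n V''"
    using tree_space_is_word_graph T by metis
  show "tree_dist n T T'' \<le> tree_dist n T T' + tree_dist n T' T''"
  proof (cases "T = T' \<or> T' = T''")
    case True
    then show ?thesis
      by (auto simp: tree_dist_def)
  next
    case False
    \<comment> \<open>Agreement of balls of a common radius is transitive, whence the ultrametric inequality.\<close>
    define r where "r = min (agree_radius n T T') (agree_radius n T' T'')"
    have "truncate V r = truncate V' r" "truncate V' r = truncate V'' r"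
      using le_agree_radius_iff[OF pc(1,2), of r] le_agree_radius_iff[OF pc(2,3), of r] False
      by (auto simp: eq r_def)
    then have "tree_dist n T T'' \<le> exp (- real r)"
      using tree_dist_le[OF pc(1,3), of r] eq by simp
    also have "\<dots> \<le> tree_dist n T T' + tree_dist n T' T''"
      using False by (auto simp: tree_dist_def r_def min_def)
    finally show ?thesis .
  qed
qed

section \<open>Reading a configuration along words\<close>

locale edge_coding = group G for G :: "('g, 'm) monoid_scheme" (structure) +
  fixes S :: "'s set" and Gp :: "'g set" and n :: nat and \<alpha> :: "'g \<times> 's \<Rightarrow> letter list"
  assumes finite_S: "finite S" and finite_Gp: "finite Gp"
    and Gp_carrier: "Gp \<subseteq> carrier G" and Gp_nonempty: "Gp \<noteq> {}"
    and generating: "generate G (Gp \<union> (\<lambda>g. inv g) ` Gp) = carrier G"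
    and \<alpha>_free_gens: "\<alpha> \<in> Gp \<times> S \<rightarrow> free_gens n"
    and \<alpha>_inj: "inj_on \<alpha> (Gp \<times> S)"
begin

abbreviation configs :: "('g \<Rightarrow> 's) set" where
  "configs \<equiv> bernoulli_space G S"

abbreviation gens :: "'g set" where
  "gens \<equiv> Gp \<union> (\<lambda>g. inv g) ` Gp"

text \<open>
  \<open>crosses \<sigma> x g\<close> says that the letter \<open>x\<close> leads from the identity along the generator \<open>g\<close>. In the
  second case \<open>g\<close> is negative and the edge is traversed from its end to its start, which is the
  vertex \<open>g\<close>; so its label depends on the value \<open>\<sigma> g\<close> and is read as an inverse.
\<close>

definition crosses :: "('g \<Rightarrow> 's) \<Rightarrow> letter \<Rightarrow> 'g \<Rightarrow> bool" where
  "crosses \<sigma> x g \<longleftrightarrow>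
    g \<in> Gp \<and> \<alpha> (g, \<sigma> \<one>) = [x] \<or>
    g \<in> carrier G \<and> inv g \<in> Gp \<and> \<alpha> (inv g, \<sigma> g) = [flip x]"

primrec run :: "('g \<Rightarrow> 's) \<Rightarrow> letter list \<Rightarrow> ('g \<Rightarrow> 's) \<Rightarrow> bool" where
  "run \<sigma> [] \<tau> \<longleftrightarrow> \<tau> = \<sigma>"
| "run \<sigma> (x # w) \<tau> \<longleftrightarrow> (\<exists>g. crosses \<sigma> x g \<and> run (shift G \<sigma> g) w \<tau>)"

definition readable :: "('g \<Rightarrow> 's) \<Rightarrow> letter list set" where
  "readable \<sigma> = {w. reduced_word w \<and> (\<exists>\<tau>. run \<sigma> w \<tau>)}"

definition config_tree :: "('g \<Rightarrow> 's) \<Rightarrow> lgraph" where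
  "config_tree \<sigma> = word_graph n (readable \<sigma>)"

lemma gens_carrier: "gens \<subseteq> carrier G"
  using Gp_carrier by auto

lemma configs_apply: "\<sigma> \<in> configs \<Longrightarrow> g \<in> carrier G \<Longrightarrow> \<sigma> g \<in> S"
  by (auto simp: bernoulli_space_def)

lemma shift_apply:
  fixes \<sigma> :: "'g \<Rightarrow> 's"
  shows "h \<in> carrier G \<Longrightarrow> shift G \<sigma> g h = \<sigma> (g \<otimes> h)"
  by (simp add: shift_def)

lemma shift_in_configs: "\<sigma> \<in> configs \<Longrightarrow> g \<in> carrier G \<Longrightarrow> shift G \<sigma> g \<in> configs"
  by (auto simp: bernoulli_space_def shift_def)

lemma shift_one: "\<sigma> \<in> configs \<Longrightarrow> shift G \<sigma> \<one> = \<sigma>"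
  by (auto simp: bernoulli_space_def shift_def PiE_iff extensional_def)

lemma shift_shift:
  fixes \<sigma> :: "'g \<Rightarrow> 's"
  shows "g \<in> carrier G \<Longrightarrow> h \<in> carrier G \<Longrightarrow> shift G (shift G \<sigma> g) h = shift G \<sigma> (g \<otimes> h)"
  by (auto simp: shift_def m_assoc)

lemma \<alpha>_letter:
  assumes "g \<in> Gp" "s \<in> S"
  obtains i where "\<alpha> (g, s) = [(i, True)]" "i < n"
  using assms \<alpha>_free_gens by (auto simp: free_gens_def Pi_iff)

lemma crosses_gens: "crosses \<sigma> x g \<Longrightarrow> g \<in> gens"
  by (auto simp: crosses_def) (metis image_eqI inv_inv)

lemma crosses_carrier: "crosses \<sigma> x g \<Longrightarrow> g \<in> carrier G"
  using crosses_gens gens_carrier by blast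

lemma crosses_letter:
  assumes "\<sigma> \<in> configs" "crosses \<sigma> x g"
  shows "fst x < n"
proof -
  have "\<sigma> \<one> \<in> S" "\<sigma> g \<in> S"
    using assms crosses_carrier configs_apply by auto
  then show ?thesis
    using assms(2) unfolding crosses_def
    by (metis \<alpha>_letter fst_conv fst_flip list.inject)
qed

lemma crosses_flip:
  assumes "crosses \<sigma> x g"
  shows "crosses (shift G \<sigma> g) (flip x) (inv g)"
  using assms crosses_carrier[OF assms] by (auto simp: crosses_def shift_apply)

text \<open>
  The letter alone determines the generator, uniformly in the configuration: its sign tells which
  case of \<^const>\<open>crosses\<close> applies, since \<open>\<alpha>\<close> takes positive values, and injectivity of \<open>\<alpha>\<close> does the
  rest. With \<open>\<sigma> = \<tau>\<close> this is determinism of reading; for different configurations it is what makes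
  the tree determine the configuration.
\<close>

lemma crosses_unique:
  assumes "\<sigma> \<in> configs" "\<tau> \<in> configs" "crosses \<sigma> x g" "crosses \<tau> x h"
  shows "g = h"
proof -
  have S: "\<sigma> \<one> \<in> S" "\<sigma> g \<in> S" "\<tau> \<one> \<in> S" "\<tau> h \<in> S"
    using assms crosses_carrier configs_apply by auto
  have positive: "snd y" if "\<alpha> (k, s) = [y]" "k \<in> Gp" "s \<in> S" for k s y
    using that \<alpha>_letter by (metis list.inject snd_conv)
  have carrier: "g \<in> carrier G" "h \<in> carrier G"
    using assms crosses_carrier by auto
  show ?thesis
  proof (cases "snd x")
    case True
    then have "\<alpha> (k, s) \<noteq> [flip x]" if "k \<in> Gp" "s \<in> S" for k s
      using positive[of k s "flip x"] that by (auto simp: flip_def)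
    then have "g \<in> Gp" "h \<in> Gp" "\<alpha> (g, \<sigma> \<one>) = \<alpha> (h, \<tau> \<one>)"
      using assms(3,4) S unfolding crosses_def by metis+
    then show ?thesis
      using \<alpha>_inj S by (auto dest: inj_onD)
  next
    case False
    then have "\<alpha> (k, s) \<noteq> [x]" if "k \<in> Gp" "s \<in> S" for k s
      using positive[of k s x] that by blast
    then have "inv g \<in> Gp" "inv h \<in> Gp" "\<alpha> (inv g, \<sigma> g) = \<alpha> (inv h, \<tau> h)"
      using assms(3,4) S unfolding crosses_def by metis+
    then have "inv g = inv h"
      using \<alpha>_inj S by (auto dest: inj_onD)
    then show ?thesis
      using carrier inv_inv by metis
  qed
qed

lemma gens_crossed:
  assumes "\<sigma> \<in> configs" "g \<in> gens"
  obtains x where "crosses \<sigma> x g"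
proof (cases "g \<in> Gp")
  case True
  then obtain i where "\<alpha> (g, \<sigma> \<one>) = [(i, True)]"
    using \<alpha>_letter configs_apply assms(1) by (metis one_closed)
  then show ?thesis
    using that True by (auto simp: crosses_def)
next
  case False
  then have g: "g \<in> carrier G" "inv g \<in> Gp"
    using assms(2) gens_carrier Gp_carrier by auto
  then obtain i where "\<alpha> (inv g, \<sigma> g) = [(i, True)]"
    using \<alpha>_letter configs_apply assms(1) by metis
  then have "crosses \<sigma> (flip (i, True)) g"
    using g by (simp add: crosses_def)
  then show ?thesis
    using that by blast
qed

lemma run_append: "run \<sigma> (u @ w) \<tau> \<longleftrightarrow> (\<exists>\<rho>. run \<sigma> u \<rho> \<and> run \<rho> w \<tau>)"
  by (induction u arbitrary: \<sigma>) auto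

lemma run_shift:
  assumes "run \<sigma> w \<tau>" "\<sigma> \<in> configs"
  shows "\<exists>g\<in>carrier G. \<tau> = shift G \<sigma> g"
  using assms
proof (induction w arbitrary: \<sigma>)
  case Nil
  then show ?case
    using shift_one by (intro bexI[of _ "\<one>"]) auto
next
  case (Cons x w)
  then obtain g where g: "crosses \<sigma> x g" "run (shift G \<sigma> g) w \<tau>"
    by auto
  then have "g \<in> carrier G"
    using crosses_carrier by blast
  moreover from this obtain h where "h \<in> carrier G" "\<tau> = shift G (shift G \<sigma> g) h"
    using Cons g shift_in_configs by blast
  ultimately show ?case
    using shift_shift m_closed by metis
qed

lemma run_in_configs: "run \<sigma> w \<tau> \<Longrightarrow> \<sigma> \<in> configs \<Longrightarrow> \<tau> \<in> configs"
  using run_shift shift_in_configs by metis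

lemma run_letters:
  "run \<sigma> w \<tau> \<Longrightarrow> \<sigma> \<in> configs \<Longrightarrow> fst ` set w \<subseteq> {..<n}"
proof (induction w arbitrary: \<sigma>)
  case (Cons x w)
  then obtain g where g: "crosses \<sigma> x g" "run (shift G \<sigma> g) w \<tau>"
    by auto
  then have "fst ` set w \<subseteq> {..<n}"
    using Cons crosses_carrier shift_in_configs by blast
  then show ?case
    using crosses_letter[OF Cons.prems(2) g(1)] by simp
qed simp

lemma crosses_back:
  assumes "\<sigma> \<in> configs" "crosses \<sigma> x g" "crosses (shift G \<sigma> g) (flip x) h"
  shows "shift G (shift G \<sigma> g) h = \<sigma>"
proof -
  have g: "g \<in> carrier G"
    using assms crosses_carrier by blast
  have "h = inv g"
    using crosses_unique[OF _ _ assms(3) crosses_flip[OF assms(2)]] shift_in_configs[OF assms(1) g]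
    by blast
  then show ?thesis
    using g shift_shift shift_one assms(1) by simp
qed

text \<open>
  Reading is compatible with free reduction, because a letter followed by its inverse leads back to
  the same configuration.
\<close>

lemma run_push:
  assumes "\<sigma> \<in> configs" "crosses \<sigma> x g" "run (shift G \<sigma> g) w \<tau>"
  shows "run \<sigma> (push x w) \<tau>"
proof (cases "\<exists>v. w = flip x # v")
  case True
  then obtain v h where "w = flip x # v" "crosses (shift G \<sigma> g) (flip x) h"
    "run (shift G (shift G \<sigma> g) h) v \<tau>"
    using assms(3) by auto
  then show ?thesis
    using crosses_back[OF assms(1,2)] by simp
next
  case False
  then have "push x w = x # w"
    by (cases w) auto
  then show ?thesis
    using assms by auto
qed

lemma run_foldr_push:
  "run \<sigma> u \<rho> \<Longrightarrow> run \<rho> w \<tau> \<Longrightarrow> \<sigma> \<in> configs \<Longrightarrow> run \<sigma> (foldr push u w) \<tau>"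
proof (induction u arbitrary: \<sigma>)
  case (Cons x u)
  then obtain g where g: "crosses \<sigma> x g" "run (shift G \<sigma> g) u \<rho>"
    by auto
  then have "run (shift G \<sigma> g) (foldr push u w) \<tau>"
    using Cons crosses_carrier shift_in_configs by blast
  then show ?case
    using run_push Cons.prems(3) g(1) by simp
qed simp

lemma run_inverse:
  "run \<sigma> u \<tau> \<Longrightarrow> \<sigma> \<in> configs \<Longrightarrow> run \<tau> (rev (map flip u)) \<sigma>"
proof (induction u arbitrary: \<sigma>)
  case (Cons x u)
  then obtain g where g: "crosses \<sigma> x g" "run (shift G \<sigma> g) u \<tau>"
    by auto
  then have "run \<tau> (rev (map flip u)) (shift G \<sigma> g)"
    using Cons crosses_carrier shift_in_configs by blast
  moreover have "run (shift G \<sigma> g) [flip x] \<sigma>"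
    using crosses_flip[OF g(1)] crosses_back[OF Cons.prems(2) g(1)] by (metis run.simps)
  ultimately show ?case
    by (auto simp: run_append simp del: run.simps)
qed simp

lemma readable_carrier: "\<sigma> \<in> configs \<Longrightarrow> readable \<sigma> \<subseteq> carrier (free_group n)"
  using run_letters by (auto simp: readable_def carrier_free_group_iff)

lemma prefix_closed_readable:
  assumes "\<sigma> \<in> configs"
  shows "prefix_closed n (readable \<sigma>)"
  using readable_carrier[OF assms] unfolding prefix_closed_def
  by (auto simp: readable_def run_append dest: reduced_appendD)

text \<open>
  Repeating one positive generator yields readable words of any length in positive letters, and
  such words are reduced.
\<close>

lemma infinite_readable:
  assumes "\<sigma> \<in> configs"
  shows "infinite (readable \<sigma>)"
proof -
  obtain g where g: "g \<in> Gp"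
    using Gp_nonempty by blast
  have "\<exists>w \<tau>. run \<sigma> w \<tau> \<and> length w = k \<and> (\<forall>x\<in>set w. snd x)" for k
    using assms
  proof (induction k arbitrary: \<sigma>)
    case 0
    show ?case
      by (intro exI[of _ "[]"] exI[of _ \<sigma>]) simp
  next
    case (Suc k)
    have "g \<in> carrier G"
      using g Gp_carrier by blast
    then obtain w \<tau> where w: "run (shift G \<sigma> g) w \<tau>" "length w = k" "\<forall>x\<in>set w. snd x"
      using Suc shift_in_configs by meson
    obtain i where "\<alpha> (g, \<sigma> \<one>) = [(i, True)]"
      using \<alpha>_letter g configs_apply Suc.prems by (metis one_closed)
    then have "run \<sigma> ((i, True) # w) \<tau>"
      using w g by (auto simp: crosses_def)
    then show ?case
      using w by (intro exI[of _ "(i, True) # w"] exI[of _ \<tau>]) simp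
  qed
  moreover have "reduced_word w" if "\<forall>x\<in>set w. snd x" for w
    using that
  proof (induction w)
    case (Cons x w)
    then have "hd w \<noteq> flip x" if "w \<noteq> []"
      using hd_in_set[OF that] by (metis flip_def list.set_intros snd_conv)
    then show ?case
      using Cons by (auto simp: reduced_Cons)
  qed simp
  ultimately have "\<exists>w\<in>readable \<sigma>. length w = k" for k
    unfolding readable_def by blast
  then have "k \<in> length ` readable \<sigma>" for k
    by (metis imageI)
  then have "length ` readable \<sigma> = UNIV"
    by blast
  then show ?thesis
    by (metis finite_imageI infinite_UNIV_nat)
qed

section \<open>The shift as a partial action on trees\<close>

lemma config_tree_in_tree_space: "\<sigma> \<in> configs \<Longrightarrow> config_tree \<sigma> \<in> tree_space n"
  unfolding config_tree_def
  by (intro word_graph_in_tree_space prefix_closed_readable infinite_readable)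

lemma readable_translate:
  assumes "\<sigma> \<in> configs" "run \<sigma> f \<tau>"
  shows "readable \<sigma> = foldr push f ` readable \<tau>"
proof -
  have \<tau>: "\<tau> \<in> configs"
    using assms run_in_configs by blast
  have "foldr push f w \<in> readable \<sigma>" if "w \<in> readable \<tau>" for w
    using that run_foldr_push[OF assms(2) _ assms(1)] reduced_foldr_push
    by (auto simp: readable_def)
  moreover have "foldr push (rev (map flip f)) w \<in> readable \<tau>" if "w \<in> readable \<sigma>" for w
    using that run_foldr_push[OF run_inverse[OF assms(2,1)] _ \<tau>] reduced_foldr_push
    by (auto simp: readable_def)
  moreover have "foldr push f (foldr push (rev (map flip f)) w) = w" if "w \<in> readable \<sigma>" for w
    using that foldr_push_inverse_right by (auto simp: readable_def)
  ultimately show ?thesis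
    by (metis (no_types, lifting) image_iff subsetI subset_antisym)
qed

text \<open>
  By \<open>pointed_iso_word_graph\<close>, a tree isomorphic to the tree of \<open>\<sigma>\<close> pointed at \<open>f\<close> must have the
  translate of \<^term>\<open>readable \<sigma>\<close> by \<open>f\<inverse>\<close> as its vertex set, and this is \<^term>\<open>readable \<tau>\<close>.
\<close>

lemma config_tree_run:
  assumes "\<sigma> \<in> configs" "run \<sigma> f \<tau>" "reduced_word f"
  shows "config_tree \<tau> = tree_act n (config_tree \<sigma>) f"
proof -
  have \<tau>: "\<tau> \<in> configs"
    using assms run_in_configs by blast
  have f: "f \<in> carrier (free_group n)"
    using assms run_letters by (auto simp: carrier_free_group_iff)
  note iso = pointed_iso_word_graph[OF _ readable_carrier[OF assms(1)] f]
  have "tree_act n (config_tree \<sigma>) f = config_tree \<tau>"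
    unfolding tree_act_def
  proof (rule the_equality)
    show "config_tree \<tau> \<in> tree_space n \<and>
      pointed_iso (config_tree \<tau>) \<one>\<^bsub>free_group n\<^esub> (config_tree \<sigma>) f"
      using config_tree_in_tree_space[OF \<tau>] iso[OF prefix_closed_readable[OF \<tau>]]
        readable_translate[OF assms(1,2)]
      by (simp add: config_tree_def one_free_group)
  next
    fix T assume T: "T \<in> tree_space n \<and> pointed_iso T \<one>\<^bsub>free_group n\<^esub> (config_tree \<sigma>) f"
    then obtain V where V: "prefix_closed n V" "T = word_graph n V"
      using tree_space_is_word_graph by metis
    then have "foldr push f ` V = foldr push f ` readable \<tau>"
      using T iso[OF V(1)] readable_translate[OF assms(1,2)]
      by (simp add: config_tree_def one_free_group)
    moreover have "inj_on (foldr push f) (carrier (free_group n))"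
      by (rule inj_on_inverseI[where g = "foldr push (rev (map flip f))"])
        (simp add: carrier_free_group_iff foldr_push_inverse)
    ultimately have "V = readable \<tau>"
      using inj_on_image_eq_iff prefix_closedD(1)[OF V(1)] readable_carrier[OF \<tau>] by metis
    then show "T = config_tree \<tau>"
      using V by (simp add: config_tree_def)
  qed
  then show ?thesis ..
qed

lemma config_tree_shift:
  assumes "\<sigma> \<in> configs" "crosses \<sigma> x g"
  shows "act_defined (config_tree \<sigma>) [x]"
    and "config_tree (shift G \<sigma> g) = tree_act n (config_tree \<sigma>) [x]"
proof -
  have "run \<sigma> [x] (shift G \<sigma> g)"
    using assms by auto
  moreover have "reduced_word [x]"
    by (simp add: reduced_Cons)
  ultimately show "act_defined (config_tree \<sigma>) [x]"
    "config_tree (shift G \<sigma> g) = tree_act n (config_tree \<sigma>) [x]"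
    using config_tree_run[OF assms(1)]
    by (auto simp: act_defined_def config_tree_def word_graph_simps readable_def simp del: run.simps)
qed

lemma shift_orbit_run:
  assumes "\<sigma> \<in> configs" "g \<in> carrier G"
  shows "\<exists>w. run \<sigma> w (shift G \<sigma> g)"
proof -
  have "g \<in> generate G gens"
    using assms generating by simp
  then show ?thesis
    using assms(1)
  proof (induction arbitrary: \<sigma>)
    case one
    then show ?case
      using shift_one by (intro exI[of _ "[]"]) simp
  next
    case (incl h)
    then obtain x where "crosses \<sigma> x h"
      using gens_crossed by blast
    then show ?case
      by (intro exI[of _ "[x]"]) auto
  next
    case (inv h)
    have "inv h \<in> gens"
      using inv.hyps Gp_carrier by auto
    then obtain x where "crosses \<sigma> x (inv h)"
      using gens_crossed inv.prems by blast
    then show ?case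
      by (intro exI[of _ "[x]"]) auto
  next
    case (eng h1 h2)
    have c: "h1 \<in> carrier G" "h2 \<in> carrier G"
      using eng.hyps generating by auto
    obtain u w where "run \<sigma> u (shift G \<sigma> h1)" "run (shift G \<sigma> h1) w (shift G (shift G \<sigma> h1) h2)"
      using eng.IH eng.prems shift_in_configs c by meson
    then have "run \<sigma> (u @ w) (shift G \<sigma> (h1 \<otimes> h2))"
      using shift_shift c by (auto simp: run_append)
    then show ?case ..
  qed
qed

text \<open>
  A word that reads a given element of the shift orbit need not be reduced; its reduced form
  reads the same element, and so it is a vertex of the tree.
\<close>

lemma orbit_equivalence_config_tree: "orbit_equivalence G S n config_tree"
  unfolding orbit_equivalence_def
proof (intro ballI equalityI subsetI)
  fix \<sigma> T assume \<sigma>: "\<sigma> \<in> configs"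
  {
    assume "T \<in> config_tree ` shift_orbit G \<sigma>"
    then obtain g where g: "g \<in> carrier G" "T = config_tree (shift G \<sigma> g)"
      by (auto simp: shift_orbit_def)
    then obtain w where "run \<sigma> w (shift G \<sigma> g)"
      using shift_orbit_run \<sigma> by blast
    then have run: "run \<sigma> (foldr push w []) (shift G \<sigma> g)"
      using run_foldr_push \<sigma> by simp
    have red: "reduced_word (foldr push w [])"
      by (simp add: reduced_foldr_push)
    have "foldr push w [] \<in> readable \<sigma>"
      using run red by (auto simp: readable_def)
    then show "T \<in> tree_orbit n (config_tree \<sigma>)"
      using config_tree_run[OF \<sigma> run red] g readable_carrier[OF \<sigma>]
      by (auto simp: tree_orbit_def act_defined_def config_tree_def word_graph_simps)
  next
    assume "T \<in> tree_orbit n (config_tree \<sigma>)"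
    then obtain f where f: "f \<in> readable \<sigma>" "T = tree_act n (config_tree \<sigma>) f"
      by (auto simp: tree_orbit_def act_defined_def config_tree_def word_graph_simps)
    then obtain \<tau> where \<tau>: "run \<sigma> f \<tau>" "reduced_word f"
      by (auto simp: readable_def)
    then obtain g where "g \<in> carrier G" "\<tau> = shift G \<sigma> g"
      using run_shift \<sigma> by blast
    moreover from this have "T = config_tree (shift G \<sigma> g)"
      using config_tree_run[OF \<sigma> \<tau>] f(2) by simp
    ultimately show "T \<in> config_tree ` shift_orbit G \<sigma>"
      unfolding shift_orbit_def by blast
  }
qed

section \<open>Injectivity and continuity\<close>

text \<open>
  Configurations with equal trees can cross the same letters, and by \<open>crosses_unique\<close> along the same
  generators; the label of a positive edge at the root encodes the value at the identity.
\<close>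

lemma config_tree_eq_imp:
  assumes "\<sigma> \<in> configs" "\<tau> \<in> configs" "config_tree \<sigma> = config_tree \<tau>"
  shows "\<sigma> \<one> = \<tau> \<one>" "g \<in> gens \<Longrightarrow> config_tree (shift G \<sigma> g) = config_tree (shift G \<tau> g)"
proof -
  have eq: "readable \<sigma> = readable \<tau>"
    using assms(3) by (simp add: config_tree_def word_graph_inject)
  have transfer: "crosses \<tau> x g" if "crosses \<sigma> x g" for x g
  proof -
    have "run \<sigma> [x] (shift G \<sigma> g)"
      using that by auto
    then have "[x] \<in> readable \<sigma>"
      by (auto simp: readable_def reduced_Cons simp del: run.simps)
    then obtain \<rho> where "run \<tau> [x] \<rho>"
      unfolding eq by (auto simp: readable_def simp del: run.simps)
    then obtain h where "crosses \<tau> x h"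
      by auto
    then show ?thesis
      using crosses_unique assms(1,2) that by blast
  qed
  show "config_tree (shift G \<sigma> g) = config_tree (shift G \<tau> g)" if g: "g \<in> gens"
  proof -
    obtain x where "crosses \<sigma> x g"
      using gens_crossed g assms(1) by blast
    then show ?thesis
      using config_tree_shift(2) transfer assms by metis
  qed
  obtain g where g: "g \<in> Gp"
    using Gp_nonempty by blast
  have S: "\<sigma> \<one> \<in> S" "\<tau> \<one> \<in> S" "\<tau> g \<in> S"
    using assms configs_apply g Gp_carrier by auto
  obtain i where i: "\<alpha> (g, \<sigma> \<one>) = [(i, True)]"
    using \<alpha>_letter g S by metis
  then have "crosses \<tau> (i, True) g"
    using transfer g by (auto simp: crosses_def)
  moreover have "\<alpha> (inv g, \<tau> g) \<noteq> [flip (i, True)]" if "inv g \<in> Gp"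
    using \<alpha>_letter[OF that S(3)] by (metis flip_def list.inject snd_conv)
  ultimately have "\<alpha> (g, \<tau> \<one>) = \<alpha> (g, \<sigma> \<one>)"
    using i by (auto simp: crosses_def)
  then show "\<sigma> \<one> = \<tau> \<one>"
    using \<alpha>_inj g S by (auto dest: inj_onD)
qed

lemma inj_config_tree: "inj_on config_tree configs"
proof (rule inj_onI)
  fix \<sigma> \<tau> assume \<sigma>\<tau>: "\<sigma> \<in> configs" "\<tau> \<in> configs" and eq: "config_tree \<sigma> = config_tree \<tau>"
  have "config_tree (shift G \<sigma> g) = config_tree (shift G \<tau> g)" if "g \<in> generate G gens" for g
    using that \<sigma>\<tau> eq
  proof (induction arbitrary: \<sigma> \<tau>)
    case one
    then show ?case
      by (simp add: shift_one)
  next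
    case (incl h)
    then show ?case
      using config_tree_eq_imp(2) by blast
  next
    case (inv h)
    have "inv h \<in> gens"
      using inv.hyps Gp_carrier by auto
    then show ?case
      using config_tree_eq_imp(2) inv.prems by blast
  next
    case (eng h1 h2)
    have c: "h1 \<in> carrier G" "h2 \<in> carrier G"
      using eng.hyps generating by auto
    then have "config_tree (shift G (shift G \<sigma> h1) h2) = config_tree (shift G (shift G \<tau> h1) h2)"
      using eng shift_in_configs by blast
    then show ?case
      using shift_shift c by simp
  qed
  then have "shift G \<sigma> g \<one> = shift G \<tau> g \<one>" if "g \<in> carrier G" for g
    using that generating config_tree_eq_imp(1) shift_in_configs \<sigma>\<tau> by metis
  then have "\<sigma> g = \<tau> g" if "g \<in> carrier G" for g
    using that by (metis one_closed r_one shift_apply)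
  then show "\<sigma> = \<tau>"
    using \<sigma>\<tau> by (auto simp: bernoulli_space_def intro: PiE_ext)
qed

definition window :: "'g set \<Rightarrow> nat \<Rightarrow> bool" where
  "window K r \<longleftrightarrow>
    (\<forall>\<sigma>\<in>configs. \<forall>\<tau>\<in>configs. (\<forall>k\<in>K. \<sigma> k = \<tau> k) \<longrightarrow>
      (\<forall>w \<rho>. length w \<le> r \<and> run \<sigma> w \<rho> \<longrightarrow> (\<exists>\<rho>'. run \<tau> w \<rho>')))"

lemma windowD:
  assumes "window K r" "\<sigma> \<in> configs" "\<tau> \<in> configs" "\<forall>k\<in>K. \<sigma> k = \<tau> k"
    and "length w \<le> r" "run \<sigma> w \<rho>"
  shows "\<exists>\<rho>'. run \<tau> w \<rho>'"
  using assms unfolding window_def by blast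

text \<open>
  Crossing one edge along \<open>g\<close> inspects the values at \<open>\<one>\<close> and \<open>g\<close>, and the rest of the word inspects
  the shifted configuration, that is, the values on the translate of the previous window by \<open>g\<close>.
\<close>

lemma finite_window: "\<exists>K. finite K \<and> K \<subseteq> carrier G \<and> window K r"
proof (induction r)
  case 0
  then show ?case
    by (intro exI[of _ "{}"]) (simp add: window_def)
next
  case (Suc r)
  then obtain K where K: "finite K" "K \<subseteq> carrier G" "window K r"
    by blast
  define L where "L = {\<one>} \<union> gens \<union> (\<lambda>(g, k). g \<otimes> k) ` (gens \<times> K)"
  have L: "finite L" "L \<subseteq> carrier G"
    using K finite_Gp gens_carrier by (auto simp: L_def)
  have run_L: "\<exists>\<rho>. run \<tau> w \<rho>"
    if \<sigma>\<tau>: "\<sigma> \<in> configs" "\<tau> \<in> configs" and eq: "\<forall>k\<in>L. \<sigma> k = \<tau> k"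
      and w: "length w \<le> Suc r" "run \<sigma> w \<rho>" for \<sigma> \<tau> w \<rho>
  proof (cases w)
    case (Cons x v)
    then obtain g where g: "crosses \<sigma> x g" "run (shift G \<sigma> g) v \<rho>"
      using w by auto
    have gens: "g \<in> gens" and g_carrier: "g \<in> carrier G"
      using g crosses_gens crosses_carrier by blast+
    then have "\<sigma> \<one> = \<tau> \<one>" "\<sigma> g = \<tau> g"
      using eq by (auto simp: L_def)
    then have "crosses \<tau> x g"
      using g(1) by (simp add: crosses_def)
    moreover have "\<forall>k\<in>K. shift G \<sigma> g k = shift G \<tau> g k"
    proof
      fix k assume k: "k \<in> K"
      then have "g \<otimes> k \<in> L"
        using gens by (auto simp: L_def)
      then show "shift G \<sigma> g k = shift G \<tau> g k"
        using eq k K(2) shift_apply by (metis subsetD)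
    qed
    then have "\<exists>\<rho>. run (shift G \<tau> g) v \<rho>"
      using windowD[OF K(3) _ _ _ _ g(2)] \<sigma>\<tau> g_carrier shift_in_configs w Cons by simp
    ultimately show ?thesis
      using Cons by auto
  qed auto
  have "window L (Suc r)"
    unfolding window_def by (intro ballI allI impI) (elim conjE, rule run_L)
  then show ?case
    using L by blast
qed

lemma continuous_config_tree:
  "continuous_map (bernoulli_topology G S) (tree_topology n) config_tree"
proof -
  interpret Metric_space "tree_space n" "tree_dist n"
    by (rule Metric_space_tree_dist)
  show ?thesis
    unfolding tree_topology_def continuous_map_to_metric topspace_bernoulli
  proof (intro ballI allI impI)
    fix \<sigma> and \<epsilon> :: real assume \<sigma>: "\<sigma> \<in> configs" and "\<epsilon> > 0"
    obtain r :: nat where "- ln \<epsilon> < real r"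
      using reals_Archimedean2 by blast
    then have "- real r < ln \<epsilon>" by linarith
    then have r: "exp (- real r) < \<epsilon>"
      using \<open>\<epsilon> > 0\<close> by (metis exp_less_mono exp_ln)
    obtain K where K: "finite K" "K \<subseteq> carrier G" "window K r"
      using finite_window[of r] by blast
    define U where "U = (\<Pi>\<^sub>E g\<in>carrier G. if g \<in> K then {\<sigma> g} else S)"
    have U: "\<tau> \<in> U \<longleftrightarrow> \<tau> \<in> configs \<and> (\<forall>k\<in>K. \<tau> k = \<sigma> k)" for \<tau>
      using K(2) configs_apply[OF \<sigma>] unfolding U_def bernoulli_space_def
      by (auto simp: PiE_iff split: if_splits)
    have "{g \<in> carrier G. (if g \<in> K then {\<sigma> g} else S) \<noteq> S} \<subseteq> K"
      by auto
    then have "finite {g \<in> carrier G. (if g \<in> K then {\<sigma> g} else S) \<noteq> S}"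
      using K(1) finite_subset by blast
    then have "openin (bernoulli_topology G S) U"
      unfolding bernoulli_topology_def U_def
      using configs_apply[OF \<sigma>] by (auto simp: openin_PiE_gen)
    moreover have "config_tree \<tau> \<in> mball (config_tree \<sigma>) \<epsilon>" if "\<tau> \<in> U" for \<tau>
    proof -
      have \<tau>: "\<tau> \<in> configs" "\<forall>k\<in>K. \<sigma> k = \<tau> k"
        using that U by auto
      have "(\<exists>\<rho>. run \<sigma> w \<rho>) \<longleftrightarrow> (\<exists>\<rho>. run \<tau> w \<rho>)" if "length w \<le> r" for w
        using windowD[OF K(3) \<sigma> \<tau>(1,2) that] windowD[OF K(3) \<tau>(1) \<sigma> _ that] \<tau>(2) by metis
      then have "truncate (readable \<sigma>) r = truncate (readable \<tau>) r"
        by (auto simp: readable_def)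
      then have "tree_dist n (config_tree \<sigma>) (config_tree \<tau>) < \<epsilon>"
        using tree_dist_le prefix_closed_readable \<sigma> \<tau>(1) r
        unfolding config_tree_def by (meson order.strict_trans1)
      then show ?thesis
        using config_tree_in_tree_space \<sigma> \<tau>(1) by (simp add: in_mball)
    qed
    moreover have "\<sigma> \<in> U"
      using U \<sigma> by simp
    ultimately show "\<exists>U. openin (bernoulli_topology G S) U \<and> \<sigma> \<in> U \<and>
        (\<forall>\<tau>\<in>U. config_tree \<tau> \<in> mball (config_tree \<sigma>) \<epsilon>)"
      by blast
  qed
qed

lemma embedding_config_tree:
  "embedding_map (bernoulli_topology G S) (tree_topology n) config_tree"
proof (rule continuous_imp_embedding_map)
  show "compact_space (bernoulli_topology G S)"
    unfolding bernoulli_topology_def compact_space_product_topology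
    using finite_S by (simp add: compact_space_discrete_topology)
  show "Hausdorff_space (tree_topology n)"
    unfolding tree_topology_def
    by (rule Metric_space.Hausdorff_space_mtopology[OF Metric_space_tree_dist])
  show "inj_on config_tree (topspace (bernoulli_topology G S))"
    unfolding topspace_bernoulli by (rule inj_config_tree)
qed (rule continuous_config_tree)

end

section \<open>The embedding theorem\<close>

theorem theorem1p1:
  fixes G :: "('g, 'm) monoid_scheme"
    and S :: "'s set"
    and G1 Gp Gm :: "'g set"
    and n :: nat
    and \<alpha> :: "'g \<times> 's \<Rightarrow> letter list"
  assumes "group G"
    and "carrier G \<noteq> {\<one>\<^bsub>G\<^esub>}"
    and "finite S"
    and "finite G1" and "G1 \<subseteq> carrier G" and "\<one>\<^bsub>G\<^esub> \<notin> G1"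
    and "generate G G1 = carrier G"
    and "(\<lambda>g. inv\<^bsub>G\<^esub> g) ` G1 = G1"
    and "G1 = Gp \<union> Gm" and "Gp \<inter> Gm = {}" and "Gm = (\<lambda>g. inv\<^bsub>G\<^esub> g) ` Gp"
    and "\<alpha> \<in> Gp \<times> S \<rightarrow> free_gens n" and "inj_on \<alpha> (Gp \<times> S)"
  shows "\<exists>\<Phi>. embedding_map (bernoulli_topology G S) (tree_topology n) \<Phi> \<and>
    orbit_equivalence G S n \<Phi> \<and>
    (\<forall>\<sigma>\<in>bernoulli_space G S. \<forall>g\<in>Gp.
       act_defined (\<Phi> \<sigma>) (\<alpha> (g, \<sigma> \<one>\<^bsub>G\<^esub>)) \<and>
       \<Phi> (shift G \<sigma> g) = tree_act n (\<Phi> \<sigma>) (\<alpha> (g, \<sigma> \<one>\<^bsub>G\<^esub>))) \<and>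
    (\<forall>\<sigma>\<in>bernoulli_space G S. \<forall>g\<in>G1. inv\<^bsub>G\<^esub> g \<in> Gp \<longrightarrow>
       act_defined (\<Phi> \<sigma>) (inv\<^bsub>free_group n\<^esub> (\<alpha> (inv\<^bsub>G\<^esub> g, \<sigma> g))) \<and>
       \<Phi> (shift G \<sigma> g) = tree_act n (\<Phi> \<sigma>) (inv\<^bsub>free_group n\<^esub> (\<alpha> (inv\<^bsub>G\<^esub> g, \<sigma> g))))"
proof -
  \<comment> \<open>Without positive generators the trees would be single points.\<close>
  have Gp: "Gp \<noteq> {}"
    using assms(2,7,9,11) group.generate_empty[OF assms(1)] by auto
  interpret edge_coding G S Gp n \<alpha>
  proof (intro edge_coding.intro edge_coding_axioms.intro)
    show "generate G (Gp \<union> (\<lambda>g. inv\<^bsub>G\<^esub> g) ` Gp) = carrier G"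
      using assms(7) by (simp only: assms(9,11))
    show "finite Gp" "Gp \<subseteq> carrier G"
      using assms(4,5,9) by auto
  qed (fact assms Gp)+
  have forward: "act_defined (config_tree \<sigma>) (\<alpha> (g, \<sigma> \<one>\<^bsub>G\<^esub>)) \<and>
      config_tree (shift G \<sigma> g) = tree_act n (config_tree \<sigma>) (\<alpha> (g, \<sigma> \<one>\<^bsub>G\<^esub>))"
    if \<sigma>: "\<sigma> \<in> configs" and g: "g \<in> Gp" for \<sigma> g
  proof -
    obtain i where i: "\<alpha> (g, \<sigma> \<one>\<^bsub>G\<^esub>) = [(i, True)]"
      using \<alpha>_letter[OF g configs_apply[OF \<sigma> one_closed]] by blast
    then have "crosses \<sigma> (i, True) g"
      using that by (simp add: crosses_def)
    then show ?thesis
      using config_tree_shift that(1) i by simp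
  qed
  have backward: "act_defined (config_tree \<sigma>) (inv\<^bsub>free_group n\<^esub> (\<alpha> (inv\<^bsub>G\<^esub> g, \<sigma> g))) \<and>
      config_tree (shift G \<sigma> g) =
        tree_act n (config_tree \<sigma>) (inv\<^bsub>free_group n\<^esub> (\<alpha> (inv\<^bsub>G\<^esub> g, \<sigma> g)))"
    if \<sigma>: "\<sigma> \<in> configs" and g: "g \<in> carrier G" "inv\<^bsub>G\<^esub> g \<in> Gp" for \<sigma> g
  proof -
    obtain i where i: "\<alpha> (inv\<^bsub>G\<^esub> g, \<sigma> g) = [(i, True)]" "i < n"
      using \<alpha>_letter[OF g(2) configs_apply[OF \<sigma> g(1)]] by blast
    then have "crosses \<sigma> (flip (i, True)) g"
      using that by (simp add: crosses_def)
    moreover have "inv\<^bsub>free_group n\<^esub> (\<alpha> (inv\<^bsub>G\<^esub> g, \<sigma> g)) = [flip (i, True)]"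
      using i by (simp add: inv_free_group letter_in_carrier)
    ultimately show ?thesis
      using config_tree_shift that(1) by simp
  qed
  show ?thesis
    using embedding_config_tree orbit_equivalence_config_tree forward backward assms(5) by blast
qed

end
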